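(* Let $n\ge1$, let $\{A_i\}_{i=1}^n$ and $\{B_i\}_{i=1}^n$ be separately commuting families of normal operators in $B(H)$ (the $A_i$ commute with each other and the $B_i$ commute with each other), and let $T\in B(H)$. Put $\Delta(T)=\sum_{i=1}^nA_iTB_i$ and $\Delta^*(T)=\sum_{i=1}^nA_i^*TB_i^*$, and let $$L=\Big(\sum_{i=1}^n(A_iT)(B_i)\Big)^2,\quad L_*=\Big(\sum_{i=1}^n(A_i^*T)(B_i)\Big)^2,\quad R=\Big(\sum_{i=1}^n(A_i)(TB_i)\Big)^2,\quad R_*=\Big(\sum_{i=1}^n(A_i)(TB_i^* )\Big)^2,$$ $$I_{\Delta,T}=L\cap L_*\cap R\cap R_* .$$ If $\omega\notin\Sigma(I_{\Delta,T})$, then $\Delta(T)\in\mathscr L_2$ implies $\Delta^*(T)\in\mathscr L_2$ and $\|\Delta(T)\|_2=\|\Delta^*(T)\|_2$.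
   Context: $H$ is a complex separable infinite-dimensional Hilbert space. $(X)$ denotes the principal two-sided ideal of $B(H)$ generated by the operator $X$ (here possibly $\{0\}$ or all of $B(H)$); for two-sided ideals $M,N$, $MN$ denotes their product (the linear span of the products $XY$, $X\in M$, $Y\in N$), $M+N$ their sum, and $M^2=MM$. In particular $(A_iT)(B_i)$ is the product of the principal ideals generated by $A_iT$ and $B_i$. $\omega=\langle1/n\rangle_{n\ge1}$, and $\omega\notin\Sigma(I)$ means that the diagonal operator $\mathrm{diag}\langle1,\frac12,\frac13,\dots\rangle$ (with respect to an orthonormal basis) does not belong to $I$. $\mathscr L_2$ is the Hilbert-Schmidt class and $\|\cdot\|_2$ its norm. *)

theory Defs
  imports "HOL-Analysis.Analysis"
begin

class complex_vector = real_vector +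
  fixes scaleC :: "complex \<Rightarrow> 'a \<Rightarrow> 'a"  (infixr "*\<^sub>C" 75)
  assumes scaleC_add_right: "c *\<^sub>C (x + y) = c *\<^sub>C x + c *\<^sub>C y"
    and scaleC_add_left: "(c + d) *\<^sub>C x = c *\<^sub>C x + d *\<^sub>C x"
    and scaleC_scaleC: "c *\<^sub>C (d *\<^sub>C x) = (c * d) *\<^sub>C x"
    and scaleC_one: "1 *\<^sub>C x = x"
    and scaleR_scaleC: "r *\<^sub>R x = complex_of_real r *\<^sub>C x"

global_interpretation complex_vector:
  vector_space "scaleC :: complex \<Rightarrow> 'a \<Rightarrow> 'a::complex_vector"
  by unfold_locales
    (simp_all add: scaleC_add_right scaleC_add_left scaleC_scaleC scaleC_one)

text \<open>The inner product is linear in the first argument; the norm, and hence the topology,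
  is the one it induces. Separability and infinite dimension are not part of the class.\<close>

class complex_hilbert = complex_vector + real_normed_vector + complete_space +
  fixes cinner :: "'a \<Rightarrow> 'a \<Rightarrow> complex"
  assumes cinner_commute: "cinner x y = cnj (cinner y x)"
    and cinner_add_left: "cinner (x + y) z = cinner x z + cinner y z"
    and cinner_scaleC_left: "cinner (c *\<^sub>C x) y = c * cinner x y"
    and cinner_ge_zero: "0 \<le> Re (cinner x x)"
    and norm_eq_sqrt_cinner: "norm x = sqrt (Re (cinner x x))"

definition infinite_dimensional :: "'a::complex_vector itself \<Rightarrow> bool" where
  "infinite_dimensional _ \<longleftrightarrow>
     \<not> (\<exists>S :: 'a set. finite S \<and> complex_vector.span S = UNIV)"

definition orthonormal_basis :: "(nat \<Rightarrow> 'a::complex_hilbert) \<Rightarrow> bool" where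
  "orthonormal_basis e \<longleftrightarrow>
     (\<forall>j k. cinner (e j) (e k) = (if j = k then 1 else 0)) \<and>
     closure (complex_vector.span (range e)) = UNIV"

typedef (overloaded) 'a bop =
  "{f :: 'a::complex_hilbert \<Rightarrow> 'a. bounded_linear f \<and> (\<forall>c x. f (c *\<^sub>C x) = c *\<^sub>C f x)}"
  morphisms bop_apply Abs_bop
  by (rule exI[of _ "\<lambda>x. 0"]) simp

setup_lifting type_definition_bop

lemma scaleR_scaleC_commute: "r *\<^sub>R (c *\<^sub>C x) = c *\<^sub>C (r *\<^sub>R x)"
  for x :: "'a::complex_vector"
  by (simp add: scaleR_scaleC scaleC_scaleC mult.commute)

lemma bounded_linear_scaleC: "bounded_linear ((*\<^sub>C) c :: 'a \<Rightarrow> 'a::complex_hilbert)"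
proof (rule bounded_linear_intro[where K = "cmod c"])
  fix x y :: 'a and r :: real
  show "c *\<^sub>C (x + y) = c *\<^sub>C x + c *\<^sub>C y"
    by (rule scaleC_add_right)
  show "c *\<^sub>C (r *\<^sub>R x) = r *\<^sub>R (c *\<^sub>C x)"
    by (simp add: scaleR_scaleC scaleC_scaleC mult.commute)
  have "cinner (c *\<^sub>C x) (c *\<^sub>C x) = (c * cnj c) * cinner x x"
    by (metis cinner_commute cinner_scaleC_left complex_cnj_mult mult.assoc mult.commute)
  also have "c * cnj c = complex_of_real ((cmod c)\<^sup>2)"
    by (rule complex_norm_square[symmetric])
  finally have "Re (cinner (c *\<^sub>C x) (c *\<^sub>C x)) = (cmod c)\<^sup>2 * Re (cinner x x)"
    by simp
  then show "norm (c *\<^sub>C x) \<le> norm x * cmod c"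
    by (simp add: norm_eq_sqrt_cinner real_sqrt_mult)
qed

instantiation bop :: (complex_hilbert) "{ring, complex_vector}"
begin

lift_definition zero_bop :: "'a bop" is "\<lambda>x. 0"
  by simp

lift_definition plus_bop :: "'a bop \<Rightarrow> 'a bop \<Rightarrow> 'a bop" is "\<lambda>f g x. f x + g x"
  by (auto intro: bounded_linear_add simp: scaleC_add_right)

lift_definition minus_bop :: "'a bop \<Rightarrow> 'a bop \<Rightarrow> 'a bop" is "\<lambda>f g x. f x - g x"
  by (auto intro: bounded_linear_sub simp: complex_vector.scale_right_diff_distrib)

lift_definition uminus_bop :: "'a bop \<Rightarrow> 'a bop" is "\<lambda>f x. - f x"
  by (auto intro: bounded_linear_minus)

lift_definition times_bop :: "'a bop \<Rightarrow> 'a bop \<Rightarrow> 'a bop" is "\<lambda>f g x. f (g x)"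
  by (auto intro: bounded_linear_compose)

lift_definition scaleR_bop :: "real \<Rightarrow> 'a bop \<Rightarrow> 'a bop" is "\<lambda>r f x. r *\<^sub>R f x"
  by (auto intro: bounded_linear_const_scaleR
      simp: scaleR_scaleC_commute)

lift_definition scaleC_bop :: "complex \<Rightarrow> 'a bop \<Rightarrow> 'a bop" is "\<lambda>c f x. c *\<^sub>C f x"
  by (auto intro: bounded_linear_compose[OF bounded_linear_scaleC]
      simp: scaleC_scaleC mult.commute)

instance
proof
  fix X Y Z :: "'a bop" and r s :: real and c d :: complex
  show "X + Y + Z = X + (Y + Z)" by transfer (simp add: add.assoc)
  show "X + Y = Y + X" by transfer (simp add: add.commute)
  show "0 + X = X" by transfer simp
  show "- X + X = 0" by transfer simp
  show "X - Y = X + - Y" by transfer simp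
  show "X * Y * Z = X * (Y * Z)" by transfer simp
  show "(X + Y) * Z = X * Z + Y * Z" by transfer simp
  show "X * (Y + Z) = X * Y + X * Z" by transfer (auto simp: linear_add bounded_linear.linear)
  show "r *\<^sub>R (X + Y) = r *\<^sub>R X + r *\<^sub>R Y" by transfer (simp add: scaleR_add_right)
  show "(r + s) *\<^sub>R X = r *\<^sub>R X + s *\<^sub>R X" by transfer (simp add: scaleR_add_left)
  show "r *\<^sub>R s *\<^sub>R X = (r * s) *\<^sub>R X" by transfer simp
  show "1 *\<^sub>R X = X" by transfer simp
  show "c *\<^sub>C (X + Y) = c *\<^sub>C X + c *\<^sub>C Y" by transfer (simp add: scaleC_add_right)
  show "(c + d) *\<^sub>C X = c *\<^sub>C X + d *\<^sub>C X" by transfer (simp add: scaleC_add_left)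
  show "c *\<^sub>C d *\<^sub>C X = (c * d) *\<^sub>C X" by transfer (simp add: scaleC_scaleC)
  show "1 *\<^sub>C X = X" by transfer (simp add: scaleC_one)
  show "r *\<^sub>R X = complex_of_real r *\<^sub>C X" by transfer (simp add: scaleR_scaleC)
qed

end

definition adj :: "'a::complex_hilbert bop \<Rightarrow> 'a bop" where
  "adj X = (THE Y. \<forall>x y. cinner (bop_apply X x) y = cinner x (bop_apply Y y))"

definition normal_bop :: "'a::complex_hilbert bop \<Rightarrow> bool" where
  "normal_bop X \<longleftrightarrow> adj X * X = X * adj X"

text \<open>For a bounded sequence \<open>d\<close> and an orthonormal basis \<open>e\<close> there is exactly one such
  operator; outside this case the value is unspecified.\<close>

definition diag_bop :: "(nat \<Rightarrow> 'a::complex_hilbert) \<Rightarrow> (nat \<Rightarrow> complex) \<Rightarrow> 'a bop" where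
  "diag_bop e d = (THE D. \<forall>k. bop_apply D (e k) = d k *\<^sub>C e k)"

text \<open>Sequences are indexed from 0, hence the shift.\<close>

definition omega :: "nat \<Rightarrow> complex" where
  "omega k = 1 / of_nat (k + 1)"

text \<open>On a separable infinite-dimensional space, neither the summability nor the value of the
  sum below depends on the orthonormal basis; the norm is computed in an arbitrarily chosen one.\<close>

definition hilbert_schmidt :: "'a::complex_hilbert bop \<Rightarrow> bool" where
  "hilbert_schmidt X \<longleftrightarrow>
     (\<exists>e. orthonormal_basis e \<and> summable (\<lambda>k. (norm (bop_apply X (e k)))\<^sup>2))"

definition hs_norm :: "'a::complex_hilbert bop \<Rightarrow> real" where
  "hs_norm X =
     sqrt (\<Sum>k. (norm (bop_apply X ((SOME e. orthonormal_basis e) k)))\<^sup>2)"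

text \<open>Ideals need not be closed or proper. Closure under scalar multiplication follows by
  multiplying with multiples of the identity operator.\<close>

definition two_sided_ideal :: "'a::complex_hilbert bop set \<Rightarrow> bool" where
  "two_sided_ideal M \<longleftrightarrow>
     0 \<in> M \<and> (\<forall>X\<in>M. \<forall>Y\<in>M. X + Y \<in> M) \<and> (\<forall>X\<in>M. \<forall>Z. Z * X \<in> M \<and> X * Z \<in> M)"

definition principal_ideal :: "'a::complex_hilbert bop \<Rightarrow> 'a bop set" where
  "principal_ideal X = \<Inter>{M. two_sided_ideal M \<and> X \<in> M}"

definition ideal_prod :: "'a::complex_hilbert bop set \<Rightarrow> 'a bop set \<Rightarrow> 'a bop set" where
  "ideal_prod M N = complex_vector.span {X * Y | X Y. X \<in> M \<and> Y \<in> N}"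

definition ideal_sum :: "'i set \<Rightarrow> ('i \<Rightarrow> 'a::complex_hilbert bop set) \<Rightarrow> 'a bop set" where
  "ideal_sum J M = {\<Sum>i\<in>J. X i | X. \<forall>i\<in>J. X i \<in> M i}"

definition ideal_square :: "'a::complex_hilbert bop set \<Rightarrow> 'a bop set" where
  "ideal_square M = ideal_prod M M"

text \<open>The families are indexed by \<open>{1..n}\<close>; their values elsewhere are irrelevant.\<close>

definition elem_op ::
  "nat \<Rightarrow> (nat \<Rightarrow> 'a::complex_hilbert bop) \<Rightarrow> (nat \<Rightarrow> 'a bop) \<Rightarrow> 'a bop \<Rightarrow> 'a bop" where
  "elem_op n A B T = (\<Sum>i=1..n. A i * T * B i)"

definition elem_op_star ::
  "nat \<Rightarrow> (nat \<Rightarrow> 'a::complex_hilbert bop) \<Rightarrow> (nat \<Rightarrow> 'a bop) \<Rightarrow> 'a bop \<Rightarrow> 'a bop" where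
  "elem_op_star n A B T = (\<Sum>i=1..n. adj (A i) * T * adj (B i))"

definition ideal_Delta ::
  "nat \<Rightarrow> (nat \<Rightarrow> 'a::complex_hilbert bop) \<Rightarrow> (nat \<Rightarrow> 'a bop) \<Rightarrow> 'a bop \<Rightarrow> 'a bop set" where
  "ideal_Delta n A B T =
     (let
        L = ideal_square
          (ideal_sum {1..n} (\<lambda>i. ideal_prod (principal_ideal (A i * T)) (principal_ideal (B i))));
        L' = ideal_square
          (ideal_sum {1..n} (\<lambda>i. ideal_prod (principal_ideal (adj (A i) * T)) (principal_ideal (B i))));
        R = ideal_square
          (ideal_sum {1..n} (\<lambda>i. ideal_prod (principal_ideal (A i)) (principal_ideal (T * B i))));
        R' = ideal_square
          (ideal_sum {1..n} (\<lambda>i. ideal_prod (principal_ideal (A i)) (principal_ideal (T * adj (B i)))))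
      in L \<inter> L' \<inter> R \<inter> R')"

end

theory Submission
  imports Defs "HOL-Complex_Analysis.Cauchy_Integral_Formula"
begin

text \<open>Write \<open>D\<close> for \<open>\<Delta>(T)\<close> and \<open>D'\<close> for \<open>\<Delta>*(T)\<close>. If the operators were matrices, the equality
  of the Hilbert--Schmidt norms would hold because \<open>D* D\<close> and \<open>D'* D'\<close> have the same trace: by
  Fuglede's theorem (\<open>fuglede\<close>), the adjoints of the A's commute with the A's, and similarly
  for the B's, so that the difference of these two products is a sum of commutators of the form
  \<open>[B j*, S i j * B i]\<close> and \<open>[S i j * B j*, B i]\<close> with \<open>S i j = (A j T)* (A i T)\<close>
  (\<open>elem_op_square_diff\<close>).

  In infinite dimensions the trace of a commutator \<open>[Y, Z]\<close> compressed to a finite-dimensional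
  space V does not vanish, but it comes only from the parts of Y and Z that lead out of V. If V
  contains the ranges of approximants of rank m of Y, Z and their adjoints, it is at most a constant
  times m times the product of the m-th singular numbers \<open>s m\<close> of Y and Z
  (\<open>small_traces_commutator\<close>). For the
  commutators above, the product of these numbers is bounded by the product of the singular numbers of
  \<open>A i T\<close>, \<open>B i\<close>, \<open>A j T\<close>, \<open>B j\<close>. Summation over i and j shows that the partial traces of
  \<open>D* D\<close> and \<open>D'* D'\<close> on suitable spaces V, as large as desired, differ by at most a constant times
  \<open>m (\<Sum>i. s m (A i T) * s m (B i))\<^sup>2\<close>. If this quantity comes arbitrarily close to 0, then D and D'
  have the same Hilbert--Schmidt norm (\<open>hs_bounded_elem_op_iff\<close>).

  Otherwise \<open>1/m\<close> is dominated by a constant multiple of \<open>(\<Sum>i. s m (A i T) * s m (B i))\<^sup>2\<close>.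
  A diagonal operator of numbers comparable to the singular numbers of X belongs
  to the principal ideal of X (\<open>diag_singular_values\<close>), and so the diagonal operator of \<open>1/m\<close>
  belongs to the square of the sum of the ideals \<open>(A i T) (B i)\<close> (\<open>diag_omega_in_ideal\<close>).
  The other three ideals correspond to the same statement for adjoint data.

  Orthonormal bases serve to construct adjoints, by way of the Riesz representation theorem, and
  to compute Hilbert--Schmidt norms.\<close>

instance complex_hilbert \<subseteq> banach ..

section \<open>Inner product geometry\<close>

lemma cinner_add_right: "cinner x (y + z) = cinner x y + cinner x (z :: 'a::complex_hilbert)"
  by (metis cinner_add_left cinner_commute complex_cnj_add)

lemma cinner_scaleC_right: "cinner x (c *\<^sub>C y) = cnj c * cinner x (y :: 'a::complex_hilbert)"
  by (metis cinner_commute cinner_scaleC_left complex_cnj_mult)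

lemma cinner_zero_left [simp]: "cinner 0 (y :: 'a::complex_hilbert) = 0"
  using cinner_add_left[of 0 0 y] by simp

lemma cinner_zero_right [simp]: "cinner (y :: 'a::complex_hilbert) 0 = 0"
  using cinner_add_right[of y 0 0] by simp

lemma cinner_minus_left: "cinner (- x) y = - cinner x (y :: 'a::complex_hilbert)"
  using cinner_add_left[of "- x" x y] by (simp add: eq_neg_iff_add_eq_0)

lemma cinner_minus_right: "cinner x (- y) = - cinner x (y :: 'a::complex_hilbert)"
  using cinner_add_right[of x "- y" y] by (simp add: eq_neg_iff_add_eq_0)

lemma cinner_diff_left: "cinner (x - y) z = cinner x z - cinner y (z :: 'a::complex_hilbert)"
  using cinner_add_left[of x "- y" z] by (simp add: cinner_minus_left)

lemma cinner_diff_right: "cinner x (y - z) = cinner x y - cinner x (z :: 'a::complex_hilbert)"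
  using cinner_add_right[of x y "- z"] by (simp add: cinner_minus_right)

lemma cinner_sum_left: "cinner (sum f S) y = (\<Sum>i\<in>S. cinner (f i) (y :: 'a::complex_hilbert))"
  by (induction S rule: infinite_finite_induct) (simp_all add: cinner_add_left)

lemma cinner_sum_right: "cinner y (sum f S) = (\<Sum>i\<in>S. cinner (y :: 'a::complex_hilbert) (f i))"
  by (induction S rule: infinite_finite_induct) (simp_all add: cinner_add_right)

lemmas cinner_simps =
  cinner_add_left cinner_add_right cinner_diff_left cinner_diff_right
  cinner_scaleC_left cinner_scaleC_right cinner_minus_left cinner_minus_right

lemma cinner_self: "cinner x x = complex_of_real ((norm (x :: 'a::complex_hilbert))\<^sup>2)"
proof -
  have "Im (cinner x x) = 0"
    using cinner_commute[of x x] by (metis cnj.simps(2) equal_neg_zero)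
  moreover have "Re (cinner x x) = (norm x)\<^sup>2"
    by (simp add: norm_eq_sqrt_cinner cinner_ge_zero)
  ultimately show ?thesis by (simp add: complex_eq_iff)
qed

lemma cinner_eq_zero_commute: "cinner x y = 0 \<longleftrightarrow> cinner y (x :: 'a::complex_hilbert) = 0"
  by (metis cinner_commute complex_cnj_zero)

lemma cinner_ext:
  assumes "\<And>z. cinner x z = cinner y (z :: 'a::complex_hilbert)"
  shows "x = y"
proof -
  have "cinner (x - y) (x - y) = 0" using assms by (simp add: cinner_diff_left)
  then show ?thesis by (simp add: cinner_self)
qed

lemma cinner_ext_right:
  assumes "\<And>z. cinner z x = cinner z (y :: 'a::complex_hilbert)"
  shows "x = y"
  by (rule cinner_ext) (metis assms cinner_commute)

lemma norm_scaleC [simp]: "norm (c *\<^sub>C x) = cmod c * norm (x :: 'a::complex_hilbert)"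
proof -
  have "cinner (c *\<^sub>C x) (c *\<^sub>C x) = (c * cnj c) * cinner x x"
    by (simp add: cinner_simps)
  then have "complex_of_real ((norm (c *\<^sub>C x))\<^sup>2) = complex_of_real ((cmod c)\<^sup>2 * (norm x)\<^sup>2)"
    by (simp only: cinner_self complex_norm_square[symmetric] of_real_mult[symmetric])
  then have "(norm (c *\<^sub>C x))\<^sup>2 = (cmod c * norm x)\<^sup>2"
    by (simp only: of_real_eq_iff power_mult_distrib)
  then show ?thesis by simp
qed

lemma norm_add_sq:
  "(norm (x + y))\<^sup>2 = (norm x)\<^sup>2 + (norm y)\<^sup>2 + 2 * Re (cinner x (y :: 'a::complex_hilbert))"
proof -
  have "cinner (x + y) (x + y) = cinner x x + cinner y y + (cinner x y + cnj (cinner x y))"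
    by (simp add: cinner_simps flip: cinner_commute)
  then have "Re (cinner (x + y) (x + y)) = Re (cinner x x) + Re (cinner y y) + 2 * Re (cinner x y)"
    by simp
  then show ?thesis by (simp add: cinner_self)
qed

lemma norm_add_sq_orthogonal:
  "cinner x (y :: 'a::complex_hilbert) = 0 \<Longrightarrow> (norm (x + y))\<^sup>2 = (norm x)\<^sup>2 + (norm y)\<^sup>2"
  by (simp add: norm_add_sq)

lemma norm_sum_sq_orthogonal:
  fixes f :: "'i \<Rightarrow> 'a::complex_hilbert"
  assumes "finite S" "\<And>i j. i \<in> S \<Longrightarrow> j \<in> S \<Longrightarrow> i \<noteq> j \<Longrightarrow> cinner (f i) (f j) = 0"
  shows "(norm (\<Sum>i\<in>S. f i))\<^sup>2 = (\<Sum>i\<in>S. (norm (f i))\<^sup>2)"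
  using assms
proof (induction S rule: finite_induct)
  case (insert a S)
  have "cinner (f a) (sum f S) = 0"
    unfolding cinner_sum_right using insert by (intro sum.neutral) auto
  then show ?case using insert by (simp add: norm_add_sq_orthogonal)
qed simp

text \<open>By Pythagoras, the component of x along y is no longer than x.\<close>

lemma Cauchy_Schwarz_cinner: "cmod (cinner x y) \<le> norm x * norm (y :: 'a::complex_hilbert)"
proof (cases "y = 0")
  case False
  define c where "c = cinner x y / cinner y y"
  have yy: "cinner y y \<noteq> 0" using False by (simp add: cinner_self)
  have "cinner (x - c *\<^sub>C y) (c *\<^sub>C y) = 0"
    using yy by (simp add: cinner_simps c_def)
  from norm_add_sq_orthogonal[OF this] have "(norm (c *\<^sub>C y))\<^sup>2 \<le> (norm x)\<^sup>2" by simp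
  then have "cmod c * norm y \<le> norm x" using power2_le_imp_le[of "norm (c *\<^sub>C y)"] by simp
  moreover have "cmod c = cmod (cinner x y) / (norm y)\<^sup>2"
    by (simp add: c_def norm_divide cinner_self norm_power)
  ultimately show ?thesis using False by (simp add: field_simps power2_eq_square)
qed simp

lemma bounded_linear_cinner_left:
  "bounded_linear (\<lambda>x. cinner x (y :: 'a::complex_hilbert))"
  by (rule bounded_linear_intro[where K = "norm y"])
     (auto simp: cinner_simps scaleR_scaleC Cauchy_Schwarz_cinner scaleR_conv_of_real)

lemma bounded_linear_cinner_right:
  "bounded_linear (\<lambda>x. cinner (y :: 'a::complex_hilbert) x)"
  by (rule bounded_linear_intro[where K = "norm y"])
     (auto simp: cinner_simps scaleR_scaleC scaleR_conv_of_real,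
      metis Cauchy_Schwarz_cinner mult.commute)

lemma summable_orthogonal:
  fixes f :: "nat \<Rightarrow> 'a::complex_hilbert"
  assumes orth: "\<And>i j. i \<noteq> j \<Longrightarrow> cinner (f i) (f j) = 0"
    and summ: "summable (\<lambda>k. (norm (f k))\<^sup>2)"
  shows "summable f"
  unfolding summable_Cauchy
proof (intro allI impI)
  fix r :: real assume "0 < r"
  then obtain N where N: "\<And>m n. m \<ge> N \<Longrightarrow> norm (\<Sum>k\<in>{m..<n}. (norm (f k))\<^sup>2) < r\<^sup>2"
    using summ unfolding summable_Cauchy by (meson zero_less_power)
  have "norm (sum f {m..<n}) < r" if "m \<ge> N" for m n
  proof -
    have "(norm (sum f {m..<n}))\<^sup>2 = (\<Sum>k\<in>{m..<n}. (norm (f k))\<^sup>2)"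
      by (rule norm_sum_sq_orthogonal) (auto intro: orth)
    also have "\<dots> < r\<^sup>2" using N[OF that, of n] by simp
    finally show ?thesis using \<open>0 < r\<close> by (simp add: power_less_imp_less_base)
  qed
  then show "\<exists>N. \<forall>m\<ge>N. \<forall>n. norm (sum f {m..<n}) < r" by blast
qed

section \<open>Finite orthonormal sets\<close>

definition onset :: "'a::complex_hilbert set \<Rightarrow> bool" where
  "onset F \<longleftrightarrow> finite F \<and> (\<forall>f\<in>F. \<forall>g\<in>F. cinner f g = (if f = g then 1 else 0))"

text \<open>Membership of a vector in the span of an orthonormal set F is expressed throughout by the
  equation \<open>proj F w = w\<close>.\<close>

definition proj :: "'a::complex_hilbert set \<Rightarrow> 'a \<Rightarrow> 'a" where
  "proj F x = (\<Sum>f\<in>F. cinner x f *\<^sub>C f)"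

lemma onset_norm: "onset F \<Longrightarrow> f \<in> F \<Longrightarrow> norm f = 1"
  unfolding onset_def using cinner_self[of f] by (auto simp: power2_eq_1_iff)
     (metis norm_ge_zero of_real_1 of_real_eq_iff power2_eq_1_iff neg_0_le_iff_le not_one_le_zero of_real_power)

lemma proj_add: "proj F (x + y) = proj F x + proj F y"
  by (simp add: proj_def cinner_simps scaleC_add_left sum.distrib)

lemma proj_scaleC: "proj F (c *\<^sub>C x) = c *\<^sub>C proj F x"
  by (simp add: proj_def cinner_simps scaleC_scaleC complex_vector.scale_sum_right)

lemma proj_sum: "proj F (sum g S) = (\<Sum>i\<in>S. proj F (g i))"
  by (induction S rule: infinite_finite_induct) (simp_all add: proj_add, simp_all add: proj_def)

lemma cinner_proj_left: "onset F \<Longrightarrow> f \<in> F \<Longrightarrow> cinner (proj F x) f = cinner x f"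
  unfolding proj_def onset_def
  by (simp add: cinner_sum_left cinner_simps if_distrib[of "(*) _"] sum.delta cong: if_cong)

lemma cinner_diff_proj: "onset F \<Longrightarrow> cinner (x - proj F x) (proj F y) = 0"
  by (simp add: proj_def[of F y] cinner_sum_right cinner_simps cinner_proj_left)

lemma proj_mem: "onset F \<Longrightarrow> f \<in> F \<Longrightarrow> proj F f = f"
  unfolding proj_def onset_def
  by (simp add: if_distrib[of "\<lambda>c. c *\<^sub>C _"] sum.delta scaleC_one cong: if_cong)

lemma norm_sq_proj:
  "onset F \<Longrightarrow> (norm x)\<^sup>2 = (norm (proj F x))\<^sup>2 + (norm (x - proj F x))\<^sup>2"
  using norm_add_sq_orthogonal[OF cinner_diff_proj[of F x x]] by simp

lemma norm_proj_sq:
  assumes "onset F"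
  shows "(norm (proj F x))\<^sup>2 = (\<Sum>f\<in>F. (cmod (cinner x f))\<^sup>2)"
proof -
  have "(norm (proj F x))\<^sup>2 = (\<Sum>f\<in>F. (norm (cinner x f *\<^sub>C f))\<^sup>2)"
    unfolding proj_def using assms
    by (intro norm_sum_sq_orthogonal) (auto simp: onset_def cinner_simps)
  then show ?thesis using assms by (simp add: onset_norm)
qed

lemma Bessel_onset: "onset F \<Longrightarrow> (\<Sum>f\<in>F. (cmod (cinner x f))\<^sup>2) \<le> (norm x)\<^sup>2"
  by (simp add: norm_sq_proj[of F x] norm_proj_sq)

lemma norm_diff_proj_le: "onset F \<Longrightarrow> norm (x - proj F x) \<le> norm x"
  using norm_sq_proj[of F x] by (simp add: power2_le_imp_le)

lemma proj_fixes_mono: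
  assumes "onset F" "G \<subseteq> F" "onset G" "proj G x = x"
  shows "proj F x = x"
proof -
  have "proj F x = proj F (proj G x)" using assms by simp
  also have "\<dots> = proj G x"
    unfolding proj_def[of G x] proj_sum proj_scaleC using assms
    by (intro sum.cong) (auto simp: proj_mem)
  finally show ?thesis using assms by simp
qed

text \<open>Gram--Schmidt, in the form in which it is applied: an orthonormal set is enlarged until its
  span contains prescribed vectors.\<close>

lemma onset_extend:
  assumes "finite W" "onset G"
  shows "\<exists>F. onset F \<and> G \<subseteq> F \<and> card F \<le> card G + card W \<and> (\<forall>w\<in>W. proj F w = w)"
  using assms(1)
proof (induction W rule: finite_induct)
  case empty
  then show ?case using assms(2) by auto
next
  case (insert w W)
  then obtain F where F: "onset F" "G \<subseteq> F" "card F \<le> card G + card W" "\<forall>w\<in>W. proj F w = w"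
    by blast
  show ?case
  proof (cases "proj F w = w")
    case True
    then show ?thesis using F insert by (intro exI[of _ F]) auto
  next
    case False
    define r where "r = w - proj F w"
    define g where "g = complex_of_real (1 / norm r) *\<^sub>C r"
    have r: "r \<noteq> 0" using False by (simp add: r_def)
    have gg: "cinner g g = 1" using r by (simp add: cinner_self g_def norm_divide)
    have gF: "cinner g f = 0" "cinner f g = 0" if "f \<in> F" for f
    proof -
      show "cinner g f = 0"
        using that F(1) by (simp add: g_def r_def cinner_simps cinner_proj_left)
      then show "cinner f g = 0" using cinner_eq_zero_commute by blast
    qed
    have gnF: "g \<notin> F" using gF gg by force
    let ?F = "insert g F"
    have on: "onset ?F" using F(1) gg gF gnF unfolding onset_def by auto
    have "proj ?F w = w"
    proof -
      have 1: "proj ?F (proj F w) = proj F w"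
        unfolding proj_def[of F w] proj_sum proj_scaleC using on
        by (intro sum.cong) (auto simp: proj_mem)
      have "r = complex_of_real (norm r) *\<^sub>C g" using r by (simp add: g_def scaleC_scaleC scaleC_one)
      then have 2: "proj ?F r = r" using on proj_scaleC proj_mem by (metis insertI1)
      have "w = proj F w + r" by (simp add: r_def)
      then show ?thesis using 1 2 by (metis proj_add)
    qed
    moreover have "proj ?F v = v" if "v \<in> W" for v
      using proj_fixes_mono[OF on _ F(1)] F(4) that by blast
    moreover have "card ?F \<le> card G + card (insert w W)"
      using F(1,3) insert gnF by (simp add: onset_def)
    ultimately show ?thesis using on F(2) by (intro exI[of _ ?F]) auto
  qed
qed

section \<open>Bounded operators\<close>

lemma bop_bounded_linear: "bounded_linear (bop_apply X)"
  using bop_apply[of X] by simp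

lemma bop_scaleC: "bop_apply X (c *\<^sub>C x) = c *\<^sub>C bop_apply X x"
  using bop_apply[of X] by simp

lemmas bop_add = linear_add[OF bounded_linear.linear[OF bop_bounded_linear]]
lemmas bop_diff = linear_diff[OF bounded_linear.linear[OF bop_bounded_linear]]
lemmas bop_neg = linear_neg[OF bounded_linear.linear[OF bop_bounded_linear]]
lemmas bop_zero [simp] = linear_0[OF bounded_linear.linear[OF bop_bounded_linear]]

lemmas bop_rep_eq [simp] =
  zero_bop.rep_eq plus_bop.rep_eq minus_bop.rep_eq uminus_bop.rep_eq times_bop.rep_eq
  scaleC_bop.rep_eq

lemma bop_apply_sum: "bop_apply (sum X S) x = (\<Sum>i\<in>S. bop_apply (X i) x)"
  by (induction S rule: infinite_finite_induct) simp_all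

lemma bop_eqI: "(\<And>x. bop_apply X x = bop_apply Y x) \<Longrightarrow> X = Y"
  by (metis bop_apply_inject ext)

lemma bop_exists:
  "bounded_linear f \<Longrightarrow> (\<And>c x. f (c *\<^sub>C x) = c *\<^sub>C f x) \<Longrightarrow> \<exists>X. bop_apply X = f"
  by (rule exI[of _ "Abs_bop f"]) (simp add: Abs_bop_inverse)

lemma bop_bound: obtains K where "K > 0" "\<And>x. norm (bop_apply X x) \<le> K * norm x"
  using bounded_linear.pos_bounded[OF bop_bounded_linear[of X]] by (metis mult.commute)

lemma adj_eqI:
  assumes "\<And>x y. cinner (bop_apply X x) y = cinner x (bop_apply Y y)"
  shows "adj X = Y"
  unfolding adj_def
proof (rule the_equality)
  fix Z assume Z: "\<forall>x y. cinner (bop_apply X x) y = cinner x (bop_apply Z y)"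
  show "Z = Y"
    by (rule bop_eqI, rule cinner_ext_right) (metis Z assms)
qed (use assms in blast)

lift_definition rank_one :: "'a::complex_hilbert \<Rightarrow> 'a \<Rightarrow> 'a bop" is "\<lambda>u v x. cinner x u *\<^sub>C v"
proof -
  fix u v :: 'a
  have "bounded_linear (\<lambda>x. cinner x u *\<^sub>C v)"
  proof (rule bounded_linear_intro[where K = "norm u * norm v"])
    fix x
    show "norm (cinner x u *\<^sub>C v) \<le> norm x * (norm u * norm v)"
      using mult_right_mono[OF Cauchy_Schwarz_cinner[of x u], of "norm v"] by (simp add: mult.assoc)
  qed (simp_all add: cinner_simps scaleC_add_left scaleR_scaleC scaleC_scaleC)
  then show "bounded_linear (\<lambda>x. cinner x u *\<^sub>C v) \<and>
      (\<forall>c x. cinner (c *\<^sub>C x) u *\<^sub>C v = c *\<^sub>C cinner x u *\<^sub>C v)"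
    by (simp add: cinner_simps scaleC_scaleC)
qed

section \<open>Orthonormal bases\<close>

lemma orthonormal_basis_inj: "orthonormal_basis e \<Longrightarrow> inj e"
  unfolding orthonormal_basis_def inj_def by (metis zero_neq_one)

lemma orthonormal_basis_onset: "orthonormal_basis e \<Longrightarrow> finite K \<Longrightarrow> onset (e ` K)"
  using orthonormal_basis_inj[of e]
  unfolding orthonormal_basis_def onset_def by (auto simp: inj_eq)

locale hilbert_basis =
  fixes e :: "nat \<Rightarrow> 'a::complex_hilbert"
  assumes basis: "orthonormal_basis e"
begin

lemma cinner_basis: "cinner (e j) (e k) = (if j = k then 1 else 0)"
  using basis by (simp add: orthonormal_basis_def)

lemma norm_basis [simp]: "norm (e k) = 1"
  using onset_norm[OF orthonormal_basis_onset[OF basis, of "{k}"]] by simp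

lemma proj_basis: "proj (e ` {..<n}) x = (\<Sum>k<n. cinner x (e k) *\<^sub>C e k)"
  unfolding proj_def using orthonormal_basis_inj[OF basis]
  by (subst sum.reindex) (auto intro: inj_on_subset)

text \<open>Projecting onto the first n basis vectors fixes, for large n, each vector of their dense span,
  and it never increases the distance to such a vector.\<close>

lemma basis_expansion: "(\<lambda>k. cinner x (e k) *\<^sub>C e k) sums x"
  unfolding sums_def proj_basis[symmetric]
proof (rule LIMSEQ_I)
  fix r :: real assume "0 < r"
  let ?P = "\<lambda>n. proj (e ` {..<n})"
  have on: "onset (e ` {..<n})" for n by (simp add: orthonormal_basis_onset[OF basis])
  have mono: "?P n y = y" if "?P m y = y" "m \<le> n" for m n y
    using that on by (auto intro!: proj_fixes_mono[of _ "e ` {..<m}"])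
  let ?T = "{y. \<exists>N. ?P N y = y}"
  have "complex_vector.subspace ?T"
    unfolding complex_vector.subspace_def
  proof (intro conjI ballI allI)
    show "0 \<in> ?T" by (simp add: proj_def)
    show "c *\<^sub>C y \<in> ?T" if "y \<in> ?T" for c y using that by (auto simp: proj_scaleC)
    show "y + z \<in> ?T" if "y \<in> ?T" "z \<in> ?T" for y z
    proof -
      from that obtain M N where "?P M y = y" "?P N z = z" by blast
      then have "?P (max M N) (y + z) = y + z" using mono by (simp add: proj_add)
      then show ?thesis by blast
    qed
  qed
  moreover have "range e \<subseteq> ?T"
  proof safe
    fix k show "\<exists>N. ?P N (e k) = e k" by (rule exI[of _ "Suc k"]) (simp add: on proj_mem)
  qed
  ultimately have span: "complex_vector.span (range e) \<subseteq> ?T"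
    by (rule complex_vector.span_minimal[rotated])
  have "x \<in> closure (complex_vector.span (range e))"
    using basis by (simp add: orthonormal_basis_def)
  then obtain y where y: "y \<in> complex_vector.span (range e)" "dist y x < r"
    using \<open>0 < r\<close> closure_approachable by blast
  then obtain N where N: "?P N y = y" using span by blast
  have "norm (?P n x - x) < r" if "n \<ge> N" for n
  proof -
    have d: "?P n (x - y) = ?P n x - ?P n y"
      using proj_add[of _ "x - y" y] by (simp add: eq_diff_eq)
    have "norm (?P n x - x) = norm ((x - y) - ?P n (x - y))"
      unfolding d mono[OF N that] by (subst norm_minus_commute) simp
    also have "\<dots> \<le> norm (x - y)" by (rule norm_diff_proj_le[OF on])
    also have "\<dots> < r" using y by (simp add: dist_norm norm_minus_commute)
    finally show ?thesis .
  qed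
  then show "\<exists>N. \<forall>n\<ge>N. norm (?P n x - x) < r" by blast
qed

lemma Parseval: "(\<lambda>k. (cmod (cinner x (e k)))\<^sup>2) sums (norm x)\<^sup>2"
proof -
  have "(\<lambda>n. (norm (proj (e ` {..<n}) x))\<^sup>2) \<longlonglongrightarrow> (norm x)\<^sup>2"
    using basis_expansion[of x] unfolding sums_def proj_basis[symmetric] by (intro tendsto_intros)
  moreover have "(norm (proj (e ` {..<n}) x))\<^sup>2 = (\<Sum>k<n. (cmod (cinner x (e k)))\<^sup>2)" for n
    using orthonormal_basis_inj[OF basis]
    by (subst norm_proj_sq) (auto simp: orthonormal_basis_onset[OF basis] sum.reindex inj_on_subset)
  ultimately show ?thesis by (simp add: sums_def)
qed

lemma cinner_basis_ext:
  assumes "\<And>k. cinner x (e k) = cinner y (e k)"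
  shows "x = y"
  using basis_expansion[of x] basis_expansion[of y] unfolding assms by (rule sums_unique2)

lemma bop_basis_ext:
  assumes "\<And>k. bop_apply X (e k) = bop_apply Y (e k)"
  shows "X = Y"
proof (rule bop_eqI)
  fix x
  have "(\<lambda>k. cinner x (e k) *\<^sub>C bop_apply Z (e k)) sums bop_apply Z x" for Z
    using bounded_linear.sums[OF bop_bounded_linear[of Z] basis_expansion[of x]]
    by (simp add: bop_scaleC)
  from this[of X] this[of Y] show "bop_apply X x = bop_apply Y x"
    unfolding assms by (rule sums_unique2)
qed

text \<open>The representing vector of a functional has the conjugated values on the basis as its
  coordinates; these are square summable because the functional is bounded on the partial sums.\<close>

lemma Riesz_representation:
  fixes \<phi> :: "'a \<Rightarrow> complex"
  assumes lin: "bounded_linear \<phi>" and hom: "\<And>c x. \<phi> (c *\<^sub>C x) = c * \<phi> x"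
  shows "\<exists>v. \<forall>x. \<phi> x = cinner x v"
proof -
  define f where "f k = cnj (\<phi> (e k)) *\<^sub>C e k" for k
  obtain K where K: "K > 0" "\<And>x. cmod (\<phi> x) \<le> norm x * K"
    using bounded_linear.pos_bounded[OF lin] by blast
  have orth: "cinner (f i) (f j) = 0" if "i \<noteq> j" for i j
    using that by (simp add: f_def cinner_simps cinner_basis)
  have fin: "(norm (sum f {..<n}))\<^sup>2 = (\<Sum>k<n. (norm (f k))\<^sup>2)" for n
    by (rule norm_sum_sq_orthogonal) (auto intro: orth)
  have bd: "(\<Sum>k<n. (norm (f k))\<^sup>2) \<le> K\<^sup>2" for n
  proof -
    have "\<phi> (sum f {..<n}) = (\<Sum>k<n. complex_of_real ((norm (f k))\<^sup>2))"
      unfolding linear_sum[OF bounded_linear.linear[OF lin]]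
    proof (rule sum.cong)
      fix k show "\<phi> (f k) = complex_of_real ((norm (f k))\<^sup>2)"
        unfolding f_def hom using complex_norm_square[of "\<phi> (e k)"] by (simp add: mult.commute)
    qed simp
    then have "\<phi> (sum f {..<n}) = complex_of_real ((norm (sum f {..<n}))\<^sup>2)"
      unfolding fin by simp
    then have "(norm (sum f {..<n}))\<^sup>2 \<le> norm (sum f {..<n}) * K"
      using K(2)[of "sum f {..<n}"] by (simp add: norm_power)
    then have "norm (sum f {..<n}) \<le> K"
      using K(1) by (cases "sum f {..<n} = 0") (simp_all add: power2_eq_square)
    then show ?thesis unfolding fin[symmetric] by (simp add: power_mono)
  qed
  have "summable f"
    using orth by (rule summable_orthogonal) (auto intro: summableI_nonneg_bounded bd)
  then have v: "f sums suminf f" by (rule summable_sums)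
  have vk: "cinner (e k) (suminf f) = \<phi> (e k)" for k
  proof -
    have "(\<lambda>j. cinner (e k) (f j)) sums cinner (e k) (suminf f)"
      by (rule bounded_linear.sums[OF bounded_linear_cinner_right v])
    moreover have "(\<lambda>j. cinner (e k) (f j)) = (\<lambda>j. if j = k then \<phi> (e k) else 0)"
      by (auto simp: f_def cinner_simps cinner_basis)
    ultimately show ?thesis using sums_single[of k "\<lambda>_. \<phi> (e k)"] by (metis sums_unique2)
  qed
  have "\<phi> x = cinner x (suminf f)" for x
  proof -
    have "(\<lambda>k. \<phi> (cinner x (e k) *\<^sub>C e k)) sums \<phi> x"
      by (rule bounded_linear.sums[OF lin basis_expansion])
    moreover have "(\<lambda>k. cinner (cinner x (e k) *\<^sub>C e k) (suminf f)) sums cinner x (suminf f)"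
      by (rule bounded_linear.sums[OF bounded_linear_cinner_left basis_expansion])
    ultimately show ?thesis by (simp add: hom cinner_simps vk sums_unique2)
  qed
  then show ?thesis by blast
qed

text \<open>The adjoint is introduced by a definite description; only this existence statement gives it a
  value. Its value at y represents the functional that sends x to the inner product of X x and y.\<close>

lemma adj_exists:
  fixes X :: "'a bop"
  shows "\<exists>Y. \<forall>x y. cinner (bop_apply X x) y = cinner x (bop_apply Y y)"
proof -
  have "\<exists>v. \<forall>x. cinner (bop_apply X x) y = cinner x v" for y
    by (rule Riesz_representation[where \<phi> = "\<lambda>x. cinner (bop_apply X x) y"])
       (auto intro: bounded_linear_compose[OF bounded_linear_cinner_left bop_bounded_linear]
         simp: bop_scaleC cinner_simps)
  then obtain g where g: "\<And>x y. cinner (bop_apply X x) y = cinner x (g y)" by metis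
  obtain K where K: "K > 0" "\<And>x. norm (bop_apply X x) \<le> K * norm x" using bop_bound[of X] by metis
  have hom: "g (c *\<^sub>C y) = c *\<^sub>C g y" for c y
    by (rule cinner_ext_right) (simp add: cinner_simps flip: g)
  have "bounded_linear g"
  proof (rule bounded_linear_intro[where K = K])
    show "g (y + z) = g y + g z" for y z
      by (rule cinner_ext_right) (simp add: cinner_simps flip: g)
    show "g (r *\<^sub>R y) = r *\<^sub>R g y" for r y by (simp add: scaleR_scaleC hom)
    show "norm (g y) \<le> norm y * K" for y
    proof -
      have "complex_of_real ((norm (g y))\<^sup>2) = cinner (bop_apply X (g y)) y"
        by (simp add: g cinner_self)
      then have "(norm (g y))\<^sup>2 = cmod (cinner (bop_apply X (g y)) y)"
        by (metis abs_of_nonneg norm_of_real zero_le_power2)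
      also have "\<dots> \<le> norm (bop_apply X (g y)) * norm y" by (rule Cauchy_Schwarz_cinner)
      also have "\<dots> \<le> K * norm (g y) * norm y" using K by (intro mult_right_mono) auto
      finally show ?thesis
        using K(1) by (cases "g y = 0") (simp_all add: power2_eq_square mult.commute)
    qed
  qed
  from bop_exists[OF this hom] show ?thesis using g by metis
qed

lemma cinner_adj: "cinner (bop_apply (X :: 'a bop) x) y = cinner x (bop_apply (adj X) y)"
  using adj_exists[of X] adj_eqI[of X] by metis

lemma cinner_adj': "cinner (bop_apply (adj (X :: 'a bop)) x) y = cinner x (bop_apply X y)"
  by (metis cinner_adj cinner_commute)

lemma adj_adj [simp]: "adj (adj X) = (X :: 'a bop)"
  by (rule adj_eqI) (rule cinner_adj')

lemma adj_times [simp]: "adj ((X :: 'a bop) * Y) = adj Y * adj X"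
  by (rule adj_eqI) (simp add: cinner_adj)

lemma adj_diff: "adj ((X :: 'a bop) - Y) = adj X - adj Y"
  by (rule adj_eqI) (simp add: cinner_simps cinner_adj)

lemma adj_sum: "adj (sum X S) = (\<Sum>i\<in>S. adj (X i :: 'a bop))"
  by (rule adj_eqI) (simp add: bop_apply_sum cinner_sum_left cinner_sum_right cinner_adj)

lemma adj_rank_one: "adj (rank_one u (v :: 'a)) = rank_one v u"
  by (rule adj_eqI) (simp add: rank_one.rep_eq cinner_simps mult.commute flip: cinner_commute)

lemma norm_adj_le:
  fixes X :: "'a bop"
  assumes "\<And>x. norm (bop_apply X x) \<le> K * norm x" "K \<ge> 0"
  shows "norm (bop_apply (adj X) y) \<le> K * norm y"
proof -
  let ?g = "bop_apply (adj X) y"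
  have "complex_of_real ((norm ?g)\<^sup>2) = cinner (bop_apply X ?g) y"
    by (simp add: cinner_adj cinner_self)
  then have "(norm ?g)\<^sup>2 = cmod (cinner (bop_apply X ?g) y)"
    by (metis abs_of_nonneg norm_of_real zero_le_power2)
  also have "\<dots> \<le> norm (bop_apply X ?g) * norm y" by (rule Cauchy_Schwarz_cinner)
  also have "\<dots> \<le> K * norm ?g * norm y" using assms by (intro mult_right_mono) auto
  finally show ?thesis
    using assms(2) by (cases "?g = 0") (simp_all add: power2_eq_square mult.commute)
qed

text \<open>A bounded orthogonal sequence is the image of the basis under a bounded operator. Diagonal
  operators and the contractions that diagonalize an operator arise in this way.\<close>

lemma bop_with_values:
  assumes orth: "\<And>i j. i \<noteq> j \<Longrightarrow> cinner (f i) (f j) = 0" and bd: "\<And>k. norm (f k) \<le> M"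
  shows "\<exists>X. \<forall>k. bop_apply X (e k) = f k"
proof -
  define t where "t x k = cinner x (e k) *\<^sub>C f k" for x k
  define h where "h x = suminf (t x)" for x
  have M: "M \<ge> 0" using bd[of 0] norm_ge_zero order_trans by blast
  have tb: "(norm (t x k))\<^sup>2 \<le> M\<^sup>2 * (cmod (cinner x (e k)))\<^sup>2" for x k
    using mult_right_mono[OF power_mono[OF bd[of k], of 2], of "(cmod (cinner x (e k)))\<^sup>2"]
    by (simp add: t_def power_mult_distrib mult.commute)
  have torth: "cinner (t x i) (t x j) = 0" if "i \<noteq> j" for x i j
    using orth[OF that] by (simp add: t_def cinner_simps)
  have "summable (t x)" for x
    using torth
  proof (rule summable_orthogonal)
    show "summable (\<lambda>k. (norm (t x k))\<^sup>2)"
      by (rule summable_comparison_test'[where N = 0,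
            OF summable_mult[OF sums_summable[OF Parseval[of x]], of "M\<^sup>2"]]) (use tb in simp)
  qed
  then have h: "t x sums h x" for x unfolding h_def by (rule summable_sums)
  have hom: "h (c *\<^sub>C x) = c *\<^sub>C h x" for c x
  proof -
    have "t (c *\<^sub>C x) = (\<lambda>k. c *\<^sub>C t x k)" by (auto simp: t_def cinner_simps scaleC_scaleC)
    then show ?thesis
      using h[of "c *\<^sub>C x"] bounded_linear.sums[OF bounded_linear_scaleC h[of x], of c] sums_unique2
      by metis
  qed
  have "bounded_linear h"
  proof (rule bounded_linear_intro[where K = M])
    fix x y
    have "t (x + y) = (\<lambda>k. t x k + t y k)" by (auto simp: t_def cinner_simps scaleC_add_left)
    then show "h (x + y) = h x + h y"
      using h[of "x + y"] sums_add[OF h[of x] h[of y]] sums_unique2 by metis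
    show "h (r *\<^sub>R x) = r *\<^sub>R h x" for r by (simp add: scaleR_scaleC hom)
    have "norm (sum (t x) {..<n}) \<le> norm x * M" for n
    proof (rule power2_le_imp_le)
      have "(norm (sum (t x) {..<n}))\<^sup>2 = (\<Sum>k<n. (norm (t x k))\<^sup>2)"
        by (rule norm_sum_sq_orthogonal) (auto intro: torth)
      also have "\<dots> \<le> (\<Sum>k<n. M\<^sup>2 * (cmod (cinner x (e k)))\<^sup>2)" by (rule sum_mono) (rule tb)
      also have "\<dots> = M\<^sup>2 * (\<Sum>k<n. (cmod (cinner x (e k)))\<^sup>2)" by (simp add: sum_distrib_left)
      also have "\<dots> \<le> M\<^sup>2 * (norm x)\<^sup>2"
        using sum_le_suminf[OF sums_summable[OF Parseval[of x]], of "{..<n}"]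
          sums_unique[OF Parseval[of x]] by (intro mult_left_mono) auto
      finally show "(norm (sum (t x) {..<n}))\<^sup>2 \<le> (norm x * M)\<^sup>2"
        by (simp add: power_mult_distrib mult.commute)
    qed (use M in simp)
    then show "norm (h x) \<le> norm x * M"
      using tendsto_norm[OF h[of x, unfolded sums_def]] LIMSEQ_le_const2 by blast
  qed
  from bop_exists[OF this hom] obtain X where X: "bop_apply X = h" by blast
  have "h (e k) = f k" for k
  proof -
    have "t (e k) = (\<lambda>j. if j = k then f j else 0)"
      by (auto simp: t_def cinner_basis scaleC_one)
    then show ?thesis using h[of "e k"] sums_single[of k f] by (metis sums_unique2)
  qed
  then show ?thesis using X by metis
qed

lemma bop_apply_diag:
  assumes "\<And>k. cmod (d k) \<le> M"
  shows "bop_apply (diag_bop e d) (e k) = d k *\<^sub>C e k"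
proof -
  obtain D where D: "\<forall>k. bop_apply D (e k) = d k *\<^sub>C e k"
    using bop_with_values[of "\<lambda>k. d k *\<^sub>C e k" M] assms by (auto simp: cinner_simps cinner_basis)
  have "diag_bop e d = D"
    unfolding diag_bop_def using D by (intro the_equality) (auto intro: bop_basis_ext)
  then show ?thesis using D by simp
qed

end

section \<open>Fuglede's theorem\<close>

text \<open>Rosenblum's argument considers the entire function exp(z N*) M exp(- z N*), whose derivative
  at 0 is the commutator of N* and M. It is bounded, and Liouville's theorem applies.
  The exponentials are replaced here by their approximants
  \<open>(1 + z N* / m)^m\<close>. These make the function a polynomial in z, at the price that it is
  bounded only on discs whose radius grows with m; Cauchy's estimate for the derivative at 0 on
  these discs suffices.\<close>

text \<open>The function v is weakly entire and has value v0 and derivative v1 at the origin. These two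
  data are all that Cauchy's estimate uses, and they are easy to follow through compositions.\<close>

definition entire_jet :: "(complex \<Rightarrow> 'a::complex_hilbert) \<Rightarrow> 'a \<Rightarrow> 'a \<Rightarrow> bool" where
  "entire_jet v v0 v1 \<longleftrightarrow> v 0 = v0 \<and>
     (\<forall>w. (\<lambda>z. cinner (v z) w) holomorphic_on UNIV \<and>
          ((\<lambda>z. cinner (v z) w) has_field_derivative cinner v1 w) (at 0))"

definition one_plus :: "complex \<Rightarrow> 'a::complex_hilbert bop \<Rightarrow> 'a \<Rightarrow> 'a" where
  "one_plus c X x = x + c *\<^sub>C bop_apply X x"

context hilbert_basis
begin

lemma entire_jet_bop: "entire_jet v v0 v1 \<Longrightarrow> entire_jet (\<lambda>z. bop_apply M (v z)) (bop_apply M v0) (bop_apply M (v1 :: 'a))"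
  unfolding entire_jet_def cinner_adj by blast

lemma entire_jet_one_plus:
  fixes v1 :: 'a
  assumes "entire_jet v v0 v1"
  shows "entire_jet (\<lambda>z. one_plus (z * t) X (v z)) v0 (v1 + t *\<^sub>C bop_apply X v0)"
  unfolding entire_jet_def
proof (intro conjI allI)
  fix w
  let ?f = "\<lambda>u z. cinner (v z) u"
  have eq: "(\<lambda>z. cinner (one_plus (z * t) X (v z)) w) =
      (\<lambda>z. ?f w z + z * t * ?f (bop_apply (adj X) w) z)"
    by (simp add: one_plus_def cinner_simps cinner_adj)
  have hol: "?f u holomorphic_on UNIV" and v0: "v 0 = v0"
    and der: "(?f u has_field_derivative cinner v1 u) (at 0)" for u
    using assms by (auto simp: entire_jet_def)
  show "one_plus (0 * t) X (v 0) = v0" by (simp add: one_plus_def v0)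
  show "(\<lambda>z. cinner (one_plus (z * t) X (v z)) w) holomorphic_on UNIV"
    unfolding eq by (intro holomorphic_intros hol)
  show "((\<lambda>z. cinner (one_plus (z * t) X (v z)) w) has_field_derivative
      cinner (v1 + t *\<^sub>C bop_apply X v0) w) (at 0)"
    unfolding eq
    by (rule derivative_eq_intros der refl)+ (simp add: cinner_simps cinner_adj v0)
qed

lemma entire_jet_one_plus_funpow:
  fixes v1 :: 'a
  assumes "entire_jet v v0 v1"
  shows "entire_jet (\<lambda>z. (one_plus (z * t) X ^^ j) (v z)) v0 (v1 + (of_nat j * t) *\<^sub>C bop_apply X v0)"
proof (induction j)
  case (Suc j)
  from entire_jet_one_plus[OF Suc, of t X] show ?case
    by (simp add: algebra_simps scaleC_add_left)
qed (use assms in simp)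

lemma norm_normal:
  fixes N :: "'a bop"
  assumes "normal_bop N"
  shows "norm (bop_apply (adj N) x) = norm (bop_apply N x)"
proof -
  have "bop_apply (adj N) (bop_apply N x) = bop_apply N (bop_apply (adj N) x)"
    using assms unfolding normal_bop_def by (metis times_bop.rep_eq)
  then have "cinner (bop_apply N x) (bop_apply N x) = cinner (bop_apply (adj N) x) (bop_apply (adj N) x)"
    by (simp add: cinner_adj cinner_adj')
  then show ?thesis unfolding cinner_self of_real_eq_iff by simp
qed

lemma norm_one_plus_normal:
  fixes N :: "'a bop"
  assumes "normal_bop N"
  shows "norm (one_plus c (adj N) x) = norm (one_plus (cnj c) N x)"
proof -
  have "cinner x (c *\<^sub>C bop_apply (adj N) x) = cnj (cinner x (cnj c *\<^sub>C bop_apply N x))"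
    by (simp add: cinner_simps flip: cinner_adj cinner_commute)
  then have "(norm (one_plus c (adj N) x))\<^sup>2 = (norm (one_plus (cnj c) N x))\<^sup>2"
    unfolding one_plus_def norm_add_sq by (simp add: norm_normal[OF assms])
  then show ?thesis by simp
qed

lemma funpow_commute:
  assumes "\<And>x. f (g x) = g (f x)"
  shows "f ((g ^^ m) x) = (g ^^ m) (f x)"
  by (induction m) (simp_all add: assms)

lemma one_plus_commute:
  assumes "X * Y = Y * X"
  shows "one_plus c X (one_plus d Y x) = one_plus d Y (one_plus c X x)"
proof -
  have "bop_apply X (bop_apply Y x) = bop_apply Y (bop_apply X x)"
    using assms by (metis times_bop.rep_eq)
  then show ?thesis
    by (simp add: one_plus_def bop_add bop_scaleC scaleC_add_right scaleC_scaleC mult.commute add_ac)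
qed

text \<open>The powers of \<open>1 + c N*\<close> are normal, and their adjoints are the powers of \<open>1 + cnj c N\<close>.
  The proof moves one factor at a time from N* to N.\<close>

lemma norm_one_plus_normal_funpow:
  fixes N :: "'a bop"
  assumes "normal_bop N"
  shows "norm ((one_plus c (adj N) ^^ m) x) = norm ((one_plus (cnj c) N ^^ m) x)"
proof (induction m arbitrary: x)
  case (Suc m)
  have comm: "N * adj N = adj N * N" using assms by (simp add: normal_bop_def)
  have "norm ((one_plus c (adj N) ^^ Suc m) x) = norm (one_plus (cnj c) N ((one_plus c (adj N) ^^ m) x))"
    using norm_one_plus_normal[OF assms] by simp
  also have "\<dots> = norm ((one_plus c (adj N) ^^ m) (one_plus (cnj c) N x))"
    using funpow_commute[where f = "one_plus (cnj c) N" and g = "one_plus c (adj N)", OF one_plus_commute[OF comm]]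
    by simp
  also have "\<dots> = norm ((one_plus (cnj c) N ^^ Suc m) x)"
    by (simp add: Suc funpow_swap1)
  finally show ?case .
qed simp

text \<open>The product of \<open>1 + c X\<close> and \<open>1 - c X\<close> is \<open>1 - c^2 X^2\<close>. For c of order 1/m its m-th power
  therefore has norm close to 1, so that the two powers are almost inverse to each other.\<close>

lemma norm_one_plus_minus_funpow:
  assumes L: "\<And>x. norm (bop_apply X x) \<le> L * norm x" and "L \<ge> 0"
  shows "norm ((one_plus c X ^^ m) ((one_plus (- c) X ^^ m) y)) \<le> (1 + (cmod c * L)\<^sup>2) ^ m * norm y"
proof (induction m arbitrary: y)
  case (Suc m)
  let ?P = "one_plus c X" and ?M = "one_plus (- c) X"
  have step: "norm (?P (?M y)) \<le> (1 + (cmod c * L)\<^sup>2) * norm y"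
  proof -
    have "?P (?M y) = y - (c * c) *\<^sub>C bop_apply X (bop_apply X y)"
      by (simp add: one_plus_def bop_add bop_diff bop_neg bop_scaleC scaleC_add_right
          complex_vector.scale_right_diff_distrib scaleC_scaleC)
    then have "norm (?P (?M y)) \<le> norm y + (cmod c)\<^sup>2 * norm (bop_apply X (bop_apply X y))"
      using norm_triangle_ineq4[of y "(c * c) *\<^sub>C bop_apply X (bop_apply X y)"]
      by (simp add: norm_mult power2_eq_square)
    also have "norm (bop_apply X (bop_apply X y)) \<le> L * (L * norm y)"
      using L[of "bop_apply X y"] mult_left_mono[OF L[of y] \<open>L \<ge> 0\<close>] by simp
    also have "norm y + (cmod c)\<^sup>2 * (L * (L * norm y)) = (1 + (cmod c * L)\<^sup>2) * norm y"
      by (simp add: algebra_simps power2_eq_square)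
    finally show ?thesis by (simp add: mult_left_mono)
  qed
  have "(?P ^^ Suc m) ((?M ^^ Suc m) y) = (?P ^^ m) ((?M ^^ m) (?P (?M y)))"
    using funpow_commute[where f = ?P and g = ?M, OF one_plus_commute[OF refl]]
    by (simp add: funpow_swap1)
  also have "norm \<dots> \<le> (1 + (cmod c * L)\<^sup>2) ^ m * norm (?P (?M y))" by (rule Suc)
  also have "\<dots> \<le> (1 + (cmod c * L)\<^sup>2) ^ m * ((1 + (cmod c * L)\<^sup>2) * norm y)"
    by (intro mult_left_mono step) simp
  finally show ?case by (simp add: mult_ac)
qed simp

text \<open>Without change of the norm, the power on the left may be replaced by its adjoint, which is a
  polynomial in N and commutes with M. Past M, it is turned back into a power of \<open>1 + c N*\<close> and
  almost cancels the power on the right.\<close>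

lemma fuglede_estimate:
  fixes N M :: "'a bop"
  assumes N: "normal_bop N" and comm: "N * M = M * N"
    and K: "\<And>x. norm (bop_apply M x) \<le> K * norm x" "K \<ge> 0"
    and L: "\<And>x. norm (bop_apply (adj N) x) \<le> L * norm x" "L \<ge> 0"
  shows "norm ((one_plus c (adj N) ^^ m) (bop_apply M ((one_plus (- c) (adj N) ^^ m) y)))
           \<le> K * ((1 + (cmod c * L)\<^sup>2) ^ m * norm y)"
proof -
  let ?x = "(one_plus (- c) (adj N) ^^ m) y"
  have "bop_apply M (one_plus (cnj c) N x) = one_plus (cnj c) N (bop_apply M x)" for x
    using comm by (simp add: one_plus_def bop_add bop_scaleC) (metis times_bop.rep_eq)
  then have M: "bop_apply M ((one_plus (cnj c) N ^^ m) x) = (one_plus (cnj c) N ^^ m) (bop_apply M x)" for x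
    by (rule funpow_commute)
  have "norm ((one_plus c (adj N) ^^ m) (bop_apply M ?x)) = norm (bop_apply M ((one_plus (cnj c) N ^^ m) ?x))"
    unfolding M by (rule norm_one_plus_normal_funpow[OF N])
  also have "\<dots> \<le> K * norm ((one_plus (cnj c) N ^^ m) ?x)" by (rule K)
  also have "\<dots> = K * norm ((one_plus c (adj N) ^^ m) ?x)"
    by (simp add: norm_one_plus_normal_funpow[OF N])
  also have "\<dots> \<le> K * ((1 + (cmod c * L)\<^sup>2) ^ m * norm y)"
    by (intro mult_left_mono norm_one_plus_minus_funpow L K)
  finally show ?thesis .
qed

theorem fuglede:
  fixes N M :: "'a bop"
  assumes N: "normal_bop N" and comm: "N * M = M * N"
  shows "adj N * M = M * adj N"
proof (rule bop_eqI, rule cinner_ext)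
  fix y w
  obtain K where K: "K > 0" "\<And>x. norm (bop_apply M x) \<le> K * norm x"
    using bop_bound[of M] by metis
  obtain L where L: "L > 0" "\<And>x. norm (bop_apply (adj N) x) \<le> L * norm x"
    using bop_bound[of "adj N"] by metis
  define d where "d = cinner (bop_apply (adj N * M - M * adj N) y) w"
  define C where "C = K * (exp 1 * norm y) * norm w"
  have le: "cmod d \<le> C / r" if r: "r > 0" for r :: real
  proof -
    \<comment> \<open>On the circle of radius r the estimate contains \<open>(1 + (r L / m)^2)^m\<close>, which is bounded
      by \<open>exp ((r L)^2 / m)\<close>; this choice of m keeps it below \<open>exp 1\<close> for each r.\<close>
    define m where "m = nat \<lceil>(r * L)\<^sup>2\<rceil> + 1"
    have m: "(r * L)\<^sup>2 \<le> real m" "real m > 0" unfolding m_def by linarith+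
    define t where "t = 1 / complex_of_nat m"
    have mt: "of_nat m * t = 1" using m by (simp add: t_def)
    define v where "v z = (one_plus (z * t) (adj N) ^^ m)
        (bop_apply M ((one_plus (z * - t) (adj N) ^^ m) y))" for z
    have "entire_jet (\<lambda>z. y) y 0" by (simp add: entire_jet_def)
    from entire_jet_one_plus_funpow[OF this, where j = m and X = "adj N" and t = "- t"]
    have "entire_jet (\<lambda>z. (one_plus (z * - t) (adj N) ^^ m) y) y (- bop_apply (adj N) y)"
      using mt by (simp add: scaleC_one)
    from entire_jet_one_plus_funpow[OF entire_jet_bop[OF this, of M],
        where j = m and X = "adj N" and t = t]
    have "entire_jet v (bop_apply M y) (bop_apply (adj N * M - M * adj N) y)"
      using mt by (simp add: v_def[abs_def] scaleC_one bop_neg)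
    then have hol: "(\<lambda>z. cinner (v z) w) holomorphic_on UNIV"
      and der: "((\<lambda>z. cinner (v z) w) has_field_derivative d) (at 0)"
      by (auto simp: entire_jet_def d_def)
    have bound: "cmod (cinner (v z) w) \<le> C" if "cmod (0 - z) = r" for z
    proof -
      have z: "cmod (z * t) = r / m" using that by (simp add: t_def norm_mult norm_divide)
      have "(1 + (cmod (z * t) * L)\<^sup>2) ^ m \<le> exp ((cmod (z * t) * L)\<^sup>2) ^ m"
        by (intro power_mono exp_ge_add_one_self) simp
      also have "\<dots> = exp (real m * (r / m * L)\<^sup>2)" unfolding z by (simp add: exp_of_nat_mult)
      also have "real m * (r / m * L)\<^sup>2 = (r * L)\<^sup>2 / m"
        using m(2) by (simp add: power2_eq_square field_simps)
      also have "exp ((r * L)\<^sup>2 / m) \<le> exp 1" using m by simp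
      finally have b: "K * ((1 + (cmod (z * t) * L)\<^sup>2) ^ m * norm y) \<le> K * (exp 1 * norm y)"
        using K(1) by (intro mult_left_mono mult_right_mono) auto
      have "norm (v z) \<le> K * ((1 + (cmod (z * t) * L)\<^sup>2) ^ m * norm y)"
        using fuglede_estimate[OF N comm K(2) _ L(2), where c = "z * t" and m = m and y = y] K(1) L(1) by (simp add: v_def)
      from order_trans[OF this b] have "norm (v z) * norm w \<le> C"
        unfolding C_def by (rule mult_right_mono) simp
      then show ?thesis using Cauchy_Schwarz_cinner[of "v z" w] by linarith
    qed
    have "norm ((deriv ^^ 1) (\<lambda>z. cinner (v z) w) 0) \<le> fact 1 * C / r ^ 1"
      using r bound hol
      by (intro Cauchy_inequality) (auto intro: holomorphic_on_subset holomorphic_on_imp_continuous_on)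
    then show ?thesis using DERIV_imp_deriv[OF der] by simp
  qed
  have "((\<lambda>r. C / r) \<longlongrightarrow> 0) at_top" by (rule tendsto_divide_0[OF tendsto_const filterlim_at_top_imp_at_infinity[OF filterlim_ident]])
  moreover have "eventually (\<lambda>r. cmod d \<le> C / r) at_top"
    using eventually_gt_at_top[of 0] by eventually_elim (rule le)
  ultimately have "cmod d \<le> 0" by (intro tendsto_lowerbound[of "\<lambda>r. C / r" 0 at_top]) auto
  then show "cinner (bop_apply (adj N * M) y) w = cinner (bop_apply (M * adj N) y) w"
    by (simp add: d_def cinner_simps)
qed

end

section \<open>Approximation by operators of finite rank\<close>

definition fin_rank :: "nat \<Rightarrow> 'a::complex_hilbert bop \<Rightarrow> bool" where
  "fin_rank k X \<longleftrightarrow> (\<exists>u v. X = (\<Sum>j<k. rank_one (u j) (v j)))"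

text \<open>This says that the singular number of index k of X (counted from 0) is at most
  \<open>\<epsilon>\<close>. Bounds are used instead of the number itself, since the infimum of
  the approximation errors never has to be attained or named.\<close>

definition approx :: "nat \<Rightarrow> real \<Rightarrow> 'a::complex_hilbert bop \<Rightarrow> bool" where
  "approx k \<epsilon> X \<longleftrightarrow> 0 \<le> \<epsilon> \<and>
     (\<exists>X0. fin_rank k X0 \<and> (\<forall>x. norm (bop_apply (X - X0) x) \<le> \<epsilon> * norm x))"

lemma sum_lessThan_add: "sum f {..<k + l} = sum f {..<k} + (\<Sum>j<l. f (k + j))"
  for f :: "nat \<Rightarrow> 'b::comm_monoid_add"
  by (induction l) (simp_all add: add.assoc)

lemma fin_rank_add:
  assumes "fin_rank k X" "fin_rank l Y"
  shows "fin_rank (k + l) (X + Y)"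
proof -
  from assms obtain u v u' v' where
    "X = (\<Sum>j<k. rank_one (u j) (v j))" "Y = (\<Sum>j<l. rank_one (u' j) (v' j))"
    unfolding fin_rank_def by blast
  then have "X + Y = (\<Sum>j<k + l. rank_one ((\<lambda>j. if j < k then u j else u' (j - k)) j)
      ((\<lambda>j. if j < k then v j else v' (j - k)) j))"
    by (simp add: sum_lessThan_add)
  then show ?thesis unfolding fin_rank_def by (intro exI)
qed

lemma rank_one_zero: "rank_one 0 v = 0"
  by (rule bop_eqI) (simp add: rank_one.rep_eq)

lemma fin_rank_zero: "fin_rank k 0"
  unfolding fin_rank_def by (intro exI[of _ "\<lambda>_. 0"]) (simp add: rank_one_zero)

lemma fin_rank_mono: "fin_rank k X \<Longrightarrow> k \<le> l \<Longrightarrow> fin_rank l X"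
  using fin_rank_add[of k X "l - k" 0] by (simp add: fin_rank_zero)

lemma fin_rank_left: "fin_rank k X \<Longrightarrow> fin_rank k (Z * X)"
proof -
  have "Z * rank_one u v = rank_one u (bop_apply Z v)" for u v
    by (rule bop_eqI) (simp add: rank_one.rep_eq bop_scaleC)
  then show "fin_rank k X \<Longrightarrow> fin_rank k (Z * X)"
    unfolding fin_rank_def by (force simp: sum_distrib_left)
qed

lemma approx_mono: "approx k \<epsilon> X \<Longrightarrow> k \<le> l \<Longrightarrow> approx l \<epsilon> X"
  unfolding approx_def using fin_rank_mono by blast

context hilbert_basis
begin

lemma fin_rank_adj: "fin_rank k X \<Longrightarrow> fin_rank k (adj (X :: 'a bop))"
  unfolding fin_rank_def by (force simp: adj_sum adj_rank_one)

lemma fin_rank_right: "fin_rank k X \<Longrightarrow> fin_rank k (X * (Z :: 'a bop))"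
  using fin_rank_adj[OF fin_rank_left[OF fin_rank_adj, of k X "adj Z"]] by simp

lemma approx_adj: "approx k \<epsilon> X \<Longrightarrow> approx k \<epsilon> (adj (X :: 'a bop))"
  unfolding approx_def by (metis fin_rank_adj adj_diff norm_adj_le)

text \<open>This is the inequality for the singular numbers of a product: after expansion, the product of
  the two errors is the only term without a factor of finite rank.\<close>

lemma approx_times:
  fixes X Y :: "'a bop"
  assumes "approx k \<epsilon> X" "approx l \<delta> Y"
  shows "approx (k + l) (\<epsilon> * \<delta>) (X * Y)"
proof -
  from assms obtain X0 Y0 where e: "0 \<le> \<epsilon>" "0 \<le> \<delta>" and rk: "fin_rank k X0" "fin_rank l Y0"
    and X: "\<And>x. norm (bop_apply (X - X0) x) \<le> \<epsilon> * norm x"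
    and Y: "\<And>x. norm (bop_apply (Y - Y0) x) \<le> \<delta> * norm x"
    unfolding approx_def by blast
  have eq: "X * Y - (X0 * Y + (X - X0) * Y0) = (X - X0) * (Y - Y0)" by (simp add: algebra_simps)
  have "norm (bop_apply (X * Y - (X0 * Y + (X - X0) * Y0)) x) \<le> \<epsilon> * \<delta> * norm x" for x
  proof -
    have "norm (bop_apply ((X - X0) * (Y - Y0)) x) \<le> \<epsilon> * norm (bop_apply (Y - Y0) x)"
      using X by (simp only: times_bop.rep_eq)
    also have "\<dots> \<le> \<epsilon> * (\<delta> * norm x)" using Y e by (intro mult_left_mono) auto
    finally show ?thesis unfolding eq by (simp add: mult.assoc)
  qed
  moreover have "fin_rank (k + l) (X0 * Y + (X - X0) * Y0)"
    by (intro fin_rank_add fin_rank_left fin_rank_right rk)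
  ultimately show ?thesis unfolding approx_def using e by (metis mult_nonneg_nonneg)
qed

end

section \<open>Partial traces of commutators\<close>

text \<open>All compressions of X to finite-dimensional spaces that contain w suitable vectors have a trace
  that is small in proportion to the dimension. The vectors are not fixed in advance, which makes
  this property additive: finitely many requirements on the space can be met simultaneously.\<close>

definition small_traces :: "nat \<Rightarrow> real \<Rightarrow> 'a::complex_hilbert bop \<Rightarrow> bool" where
  "small_traces w \<epsilon> X \<longleftrightarrow> (\<exists>W. finite W \<and> card W \<le> w \<and>
     (\<forall>F. onset F \<longrightarrow> (\<forall>w\<in>W. proj F w = w) \<longrightarrow>
        cmod (\<Sum>f\<in>F. cinner (bop_apply X f) f) \<le> real (card F) * \<epsilon>))"

lemma small_traces_zero: "small_traces 0 0 0"
  unfolding small_traces_def by (rule exI[of _ "{}"]) simp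

lemma small_traces_add:
  assumes "small_traces w \<epsilon> X" "small_traces w' \<epsilon>' X'"
  shows "small_traces (w + w') (\<epsilon> + \<epsilon>') (X + X')"
proof -
  from assms obtain W W' where W: "finite W" "card W \<le> w" "finite W'" "card W' \<le> w'"
    and 1: "\<And>F. onset F \<Longrightarrow> \<forall>w\<in>W. proj F w = w \<Longrightarrow>
        cmod (\<Sum>f\<in>F. cinner (bop_apply X f) f) \<le> real (card F) * \<epsilon>"
    and 2: "\<And>F. onset F \<Longrightarrow> \<forall>w\<in>W'. proj F w = w \<Longrightarrow>
        cmod (\<Sum>f\<in>F. cinner (bop_apply X' f) f) \<le> real (card F) * \<epsilon>'"
    unfolding small_traces_def by blast
  show ?thesis
    unfolding small_traces_def
  proof (intro exI[of _ "W \<union> W'"] conjI allI impI)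
    show "card (W \<union> W') \<le> w + w'" using card_Un_le[of W W'] W by linarith
    fix F :: "'a set" assume F: "onset F" "\<forall>w\<in>W \<union> W'. proj F w = w"
    have "cmod (\<Sum>f\<in>F. cinner (bop_apply (X + X') f) f) \<le>
        cmod (\<Sum>f\<in>F. cinner (bop_apply X f) f) + cmod (\<Sum>f\<in>F. cinner (bop_apply X' f) f)"
      by (simp add: cinner_simps sum.distrib norm_triangle_ineq)
    also have "\<dots> \<le> real (card F) * (\<epsilon> + \<epsilon>')"
      using 1[of F] 2[of F] F by (simp add: distrib_left add_mono)
    finally show "cmod (\<Sum>f\<in>F. cinner (bop_apply (X + X') f) f) \<le> real (card F) * (\<epsilon> + \<epsilon>')" .
  qed (use W in auto)
qed

lemma small_traces_sum:
  assumes "finite S" "\<And>i. i \<in> S \<Longrightarrow> small_traces w (\<epsilon> i) (X i)"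
  shows "small_traces (card S * w) (sum \<epsilon> S) (sum X S)"
  using assms
proof (induction S rule: finite_induct)
  case (insert a S)
  then have "small_traces (w + card S * w) (\<epsilon> a + sum \<epsilon> S) (X a + sum X S)"
    by (intro small_traces_add) auto
  then show ?case using insert by simp
qed (simp add: small_traces_zero)

lemma proj_defect:
  assumes "onset F" "\<And>j. j < k \<Longrightarrow> proj F (v j) = v j"
    and "\<And>x. norm (bop_apply (X - (\<Sum>j<k. rank_one (u j) (v j))) x) \<le> \<epsilon> * norm x"
  shows "norm (bop_apply X x - proj F (bop_apply X x)) \<le> \<epsilon> * norm x"
proof -
  define z where "z = bop_apply (\<Sum>j<k. rank_one (u j) (v j)) x"
  define y where "y = bop_apply X x - z"
  have "proj F z = z"
    by (simp add: z_def bop_apply_sum rank_one.rep_eq proj_sum proj_scaleC assms(2))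
  moreover have "bop_apply X x = y + z" by (simp add: y_def)
  ultimately have "bop_apply X x - proj F (bop_apply X x) = y - proj F y" by (simp add: proj_add)
  moreover have "norm y \<le> \<epsilon> * norm x" using assms(3)[of x] by (simp add: y_def z_def)
  ultimately show ?thesis using norm_diff_proj_le[OF assms(1), of y] by simp
qed

text \<open>The first summand is the inner product of the two projections. When Y and Z are compressed to the
  span of F, it is the part that contributes a product of finite matrices.\<close>

lemma cinner_proj_split:
  assumes "onset F"
  shows "cinner a b = (\<Sum>g\<in>F. cinner a g * cinner g b) + cinner (a - proj F a) (b - proj F b)"
proof -
  have 1: "cinner (a - proj F a) (proj F b) = 0" by (rule cinner_diff_proj[OF assms])
  have 2: "cinner (proj F a) b = (\<Sum>g\<in>F. cinner a g * cinner g b)"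
    by (simp add: proj_def cinner_sum_left cinner_simps)
  show ?thesis using 1 2 by (simp add: cinner_simps)
qed

context hilbert_basis
begin

text \<open>Compressed to the span of F, the commutator of Y and Z has as trace only the contribution
  of the parts of Y and Z that lead out of the span; the remainder is the commutator of two finite
  matrices. If the span contains the ranges of finite rank approximants of Y, Z and their adjoints,
  each of these parts is as small as the error of the approximation. The product of the two
  errors is what makes products of ideals appear.\<close>

lemma small_traces_commutator:
  fixes Y Z :: "'a bop"
  assumes "approx k \<epsilon> Y" "approx l \<delta> Z"
  shows "small_traces (2 * k + 2 * l) (2 * (\<epsilon> * \<delta>)) (Y * Z - Z * Y)"
proof -
  obtain u v where e: "\<epsilon> \<ge> 0"
    and Y: "\<And>x. norm (bop_apply (Y - (\<Sum>j<k. rank_one (u j) (v j))) x) \<le> \<epsilon> * norm x"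
    using assms(1) unfolding approx_def fin_rank_def by blast
  obtain u' v' where d: "\<delta> \<ge> 0"
    and Z: "\<And>x. norm (bop_apply (Z - (\<Sum>j<l. rank_one (u' j) (v' j))) x) \<le> \<delta> * norm x"
    using assms(2) unfolding approx_def fin_rank_def by blast
  have Y': "norm (bop_apply (adj Y - (\<Sum>j<k. rank_one (v j) (u j))) x) \<le> \<epsilon> * norm x" for x
    using norm_adj_le[OF Y e] by (simp add: adj_diff adj_sum adj_rank_one)
  have Z': "norm (bop_apply (adj Z - (\<Sum>j<l. rank_one (v' j) (u' j))) x) \<le> \<delta> * norm x" for x
    using norm_adj_le[OF Z d] by (simp add: adj_diff adj_sum adj_rank_one)
  define W where "W = (u ` {..<k} \<union> v ` {..<k}) \<union> (u' ` {..<l} \<union> v' ` {..<l})"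
  have "card W \<le> (card (u ` {..<k}) + card (v ` {..<k})) + (card (u' ` {..<l}) + card (v' ` {..<l}))"
    unfolding W_def by (intro order_trans[OF card_Un_le] add_mono card_Un_le)
  also have "\<dots> \<le> (k + k) + (l + l)"
    by (intro add_mono order_trans[OF card_image_le]) auto
  finally have cW: "card W \<le> 2 * k + 2 * l" by simp
  have "cmod (\<Sum>f\<in>F. cinner (bop_apply (Y * Z - Z * Y) f) f) \<le> real (card F) * (2 * (\<epsilon> * \<delta>))"
    if on: "onset F" and fixW: "\<forall>w\<in>W. proj F w = w" for F
  proof -
    let ?Y = "bop_apply Y" and ?Z = "bop_apply Z" and ?Y' = "bop_apply (adj Y)" and ?Z' = "bop_apply (adj Z)"
    let ?D = "\<lambda>x. x - proj F x"
    have fW: "proj F (u j) = u j" "proj F (v j) = v j" if "j < k" for j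
      using fixW that by (auto simp: W_def)
    have fW': "proj F (u' j) = u' j" "proj F (v' j) = v' j" if "j < l" for j
      using fixW that by (auto simp: W_def)
    have D: "norm (?D (?Y f)) \<le> \<epsilon>" "norm (?D (?Y' f)) \<le> \<epsilon>" "norm (?D (?Z f)) \<le> \<delta>" "norm (?D (?Z' f)) \<le> \<delta>"
      if "f \<in> F" for f
      using proj_defect[OF on fW(2) Y, of f] proj_defect[OF on fW(1) Y', of f]
        proj_defect[OF on fW'(2) Z, of f] proj_defect[OF on fW'(1) Z', of f] onset_norm[OF on that]
      by simp_all
    have "(\<Sum>f\<in>F. \<Sum>g\<in>F. cinner (?Z f) g * cinner g (?Y' f)) =
        (\<Sum>f\<in>F. \<Sum>g\<in>F. cinner (?Y f) g * cinner g (?Z' f))"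
      by (subst sum.swap) (simp add: mult.commute flip: cinner_adj)
    moreover have "(\<Sum>f\<in>F. cinner (?Z f) (?Y' f)) =
        (\<Sum>f\<in>F. \<Sum>g\<in>F. cinner (?Z f) g * cinner g (?Y' f)) + (\<Sum>f\<in>F. cinner (?D (?Z f)) (?D (?Y' f)))"
      unfolding sum.distrib[symmetric] by (intro sum.cong refl cinner_proj_split on)
    moreover have "(\<Sum>f\<in>F. cinner (?Y f) (?Z' f)) =
        (\<Sum>f\<in>F. \<Sum>g\<in>F. cinner (?Y f) g * cinner g (?Z' f)) + (\<Sum>f\<in>F. cinner (?D (?Y f)) (?D (?Z' f)))"
      unfolding sum.distrib[symmetric] by (intro sum.cong refl cinner_proj_split on)
    moreover have "cinner (bop_apply (Y * Z - Z * Y) f) f = cinner (?Z f) (?Y' f) - cinner (?Y f) (?Z' f)" for f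
      by (simp add: cinner_diff_left cinner_adj)
    ultimately have "(\<Sum>f\<in>F. cinner (bop_apply (Y * Z - Z * Y) f) f) =
        (\<Sum>f\<in>F. cinner (?D (?Z f)) (?D (?Y' f)) - cinner (?D (?Y f)) (?D (?Z' f)))"
      by (simp only: sum_subtractf add_diff_cancel_left)
    also have "cmod \<dots> \<le> (\<Sum>f\<in>F. 2 * (\<epsilon> * \<delta>))"
    proof (rule sum_norm_le)
      fix f assume f: "f \<in> F"
      have "cmod (cinner (?D (?Z f)) (?D (?Y' f))) \<le> \<delta> * \<epsilon>"
        by (rule order_trans[OF Cauchy_Schwarz_cinner]) (intro mult_mono D f norm_ge_zero d)
      moreover have "cmod (cinner (?D (?Y f)) (?D (?Z' f))) \<le> \<epsilon> * \<delta>"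
        by (rule order_trans[OF Cauchy_Schwarz_cinner]) (intro mult_mono D f norm_ge_zero e)
      ultimately show "cmod (cinner (?D (?Z f)) (?D (?Y' f)) - cinner (?D (?Y f)) (?D (?Z' f))) \<le> 2 * (\<epsilon> * \<delta>)"
        by (intro order_trans[OF norm_triangle_ineq4]) (simp add: mult.commute)
    qed
    finally show ?thesis by simp
  qed
  then show ?thesis
    unfolding small_traces_def using cW by (intro exI[of _ W]) (auto simp: W_def)
qed

text \<open>The space may also be asked to contain the first K basis vectors, so that its partial traces of a
  positive operator dominate those with respect to the basis.\<close>

lemma small_traces_on_basis:
  fixes X :: "'a bop"
  assumes "small_traces w \<epsilon> X" "\<epsilon> \<ge> 0"
  shows "\<exists>F. onset F \<and> e ` {..<K} \<subseteq> F \<and>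
    cmod (\<Sum>f\<in>F. cinner (bop_apply X f) f) \<le> real (K + w) * \<epsilon>"
proof -
  obtain W where W: "finite W" "card W \<le> w" and
    X: "\<And>F. onset F \<Longrightarrow> \<forall>w\<in>W. proj F w = w \<Longrightarrow>
        cmod (\<Sum>f\<in>F. cinner (bop_apply X f) f) \<le> real (card F) * \<epsilon>"
    using assms(1) unfolding small_traces_def by blast
  obtain F where F: "onset F" "e ` {..<K} \<subseteq> F" "card F \<le> card (e ` {..<K}) + card W"
    "\<forall>w\<in>W. proj F w = w"
    using onset_extend[OF W(1) orthonormal_basis_onset[OF basis finite_lessThan[of K]]] by blast
  have "card F \<le> K + w" using F(3) W(2) card_image_le[of "{..<K}" e] by simp
  then have "real (card F) * \<epsilon> \<le> real (K + w) * \<epsilon>" using assms(2) by (intro mult_right_mono) simp_all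
  then show ?thesis using X[OF F(1,4)] F by (intro exI[of _ F]) auto
qed

end

section \<open>The Hilbert--Schmidt norm\<close>

text \<open>The least such S is the square of the Hilbert--Schmidt norm. Its description by orthonormal sets is
  meaningful for all operators and is independent of a basis.\<close>

definition hs_bounded :: "'a::complex_hilbert bop \<Rightarrow> real \<Rightarrow> bool" where
  "hs_bounded X S \<longleftrightarrow> (\<forall>F. onset F \<longrightarrow> (\<Sum>f\<in>F. (norm (bop_apply X f))\<^sup>2) \<le> S)"

context hilbert_basis
begin

text \<open>Expand the values of the adjoint in the basis, interchange the sums, and apply Bessel's inequality
  to the values of X.\<close>

lemma hs_bounded_adjI:
  fixes X :: "'a bop"
  assumes "\<And>n. (\<Sum>k<n. (norm (bop_apply X (e k)))\<^sup>2) \<le> S"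
  shows "hs_bounded (adj X) S"
  unfolding hs_bounded_def
proof (intro allI impI)
  fix F :: "'a set" assume on: "onset F"
  have "(\<lambda>n. \<Sum>f\<in>F. \<Sum>k<n. (cmod (cinner (bop_apply (adj X) f) (e k)))\<^sup>2) \<longlonglongrightarrow>
      (\<Sum>f\<in>F. (norm (bop_apply (adj X) f))\<^sup>2)"
    by (intro tendsto_sum) (rule Parseval[unfolded sums_def])
  moreover have "(\<Sum>f\<in>F. \<Sum>k<n. (cmod (cinner (bop_apply (adj X) f) (e k)))\<^sup>2) \<le> S" for n
  proof -
    have "cmod (cinner (bop_apply (adj X) f) (e k)) = cmod (cinner (bop_apply X (e k)) f)" for f k
      by (metis cinner_adj cinner_commute complex_mod_cnj)
    then have "(\<Sum>f\<in>F. \<Sum>k<n. (cmod (cinner (bop_apply (adj X) f) (e k)))\<^sup>2) =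
        (\<Sum>k<n. \<Sum>f\<in>F. (cmod (cinner (bop_apply X (e k)) f))\<^sup>2)"
      by (subst sum.swap) simp
    also have "\<dots> \<le> (\<Sum>k<n. (norm (bop_apply X (e k)))\<^sup>2)"
      by (intro sum_mono Bessel_onset[OF on])
    finally show ?thesis using assms[of n] by linarith
  qed
  ultimately show "(\<Sum>f\<in>F. (norm (bop_apply (adj X) f))\<^sup>2) \<le> S"
    by (intro LIMSEQ_le_const2) auto
qed

lemma hs_bounded_basis:
  fixes X :: "'a bop"
  assumes "hs_bounded X S"
  shows "(\<Sum>k<n. (norm (bop_apply X (e k)))\<^sup>2) \<le> S"
proof -
  have "(\<Sum>f\<in>e ` {..<n}. (norm (bop_apply X f))\<^sup>2) \<le> S"
    using assms orthonormal_basis_onset[OF basis, of "{..<n}"] unfolding hs_bounded_def by blast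
  then show ?thesis
    by (subst (asm) sum.reindex) (auto intro: inj_on_subset[OF orthonormal_basis_inj[OF basis]])
qed

lemma hs_bounded_adj: "hs_bounded (adj (X :: 'a bop)) S \<longleftrightarrow> hs_bounded X S"
  using hs_bounded_adjI[of X] hs_bounded_adjI[of "adj X"] hs_bounded_basis by (metis adj_adj)

lemma hs_boundedI:
  "(\<And>n. (\<Sum>k<n. (norm (bop_apply X (e k)))\<^sup>2) \<le> S) \<Longrightarrow> hs_bounded (X :: 'a bop) S"
  using hs_bounded_adjI hs_bounded_adj by blast

end

text \<open>The set of bounds S determines both the membership in the Hilbert--Schmidt class and the norm. Hence
  two operators are compared by showing that they have the same bounds.\<close>

lemma hilbert_schmidt_iff:
  fixes X :: "'a::complex_hilbert bop" and e :: "nat \<Rightarrow> 'a"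
  assumes "hilbert_basis e"
  shows "hilbert_schmidt X \<longleftrightarrow> (\<exists>S. hs_bounded X S)"
proof
  assume "hilbert_schmidt X"
  then obtain b where b: "orthonormal_basis b" "summable (\<lambda>k. (norm (bop_apply X (b k)))\<^sup>2)"
    unfolding hilbert_schmidt_def by blast
  interpret b: hilbert_basis b using b(1) by unfold_locales
  have "hs_bounded X (\<Sum>k. (norm (bop_apply X (b k)))\<^sup>2)"
    by (intro b.hs_boundedI sum_le_suminf b) auto
  then show "\<exists>S. hs_bounded X S" by blast
next
  assume "\<exists>S. hs_bounded X S"
  then obtain S where S: "hs_bounded X S" by blast
  interpret hilbert_basis e by fact
  have "summable (\<lambda>k. (norm (bop_apply X (e k)))\<^sup>2)"
    by (rule summableI_nonneg_bounded[where x = S]) (simp_all add: hs_bounded_basis[OF S])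
  then show "hilbert_schmidt X" unfolding hilbert_schmidt_def using basis by blast
qed


lemma hs_norm_le_iff:
  fixes X :: "'a::complex_hilbert bop" and e :: "nat \<Rightarrow> 'a"
  assumes "hilbert_basis e" "hilbert_schmidt X"
  shows "hs_norm X \<le> S \<longleftrightarrow> S \<ge> 0 \<and> hs_bounded X (S\<^sup>2)"
proof -
  define b where "b = (SOME b :: nat \<Rightarrow> 'a. orthonormal_basis b)"
  interpret hilbert_basis b
    unfolding b_def using assms(1) by (metis hilbert_basis_def someI_ex)
  obtain S' where S': "hs_bounded X S'" using hilbert_schmidt_iff[OF assms(1)] assms(2) by blast
  have sm: "summable (\<lambda>k. (norm (bop_apply X (b k)))\<^sup>2)"
    by (rule summableI_nonneg_bounded[where x = S']) (simp_all add: hs_bounded_basis[OF S'])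
  have "(\<Sum>k. (norm (bop_apply X (b k)))\<^sup>2) \<le> S\<^sup>2 \<longleftrightarrow> hs_bounded X (S\<^sup>2)"
  proof
    assume le: "(\<Sum>k. (norm (bop_apply X (b k)))\<^sup>2) \<le> S\<^sup>2"
    show "hs_bounded X (S\<^sup>2)"
      by (intro hs_boundedI order_trans[OF sum_le_suminf[OF sm] le]) auto
  next
    assume "hs_bounded X (S\<^sup>2)"
    then show "(\<Sum>k. (norm (bop_apply X (b k)))\<^sup>2) \<le> S\<^sup>2"
      by (intro suminf_le_const sm) (rule hs_bounded_basis)
  qed
  moreover have "(\<Sum>k. (norm (bop_apply X (b k)))\<^sup>2) \<ge> 0" by (rule suminf_nonneg[OF sm]) simp
  moreover have "sqrt x \<le> S \<longleftrightarrow> S \<ge> 0 \<and> x \<le> S\<^sup>2" if "x \<ge> 0" for x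
    using order_trans[OF real_sqrt_ge_zero[OF that], of S] by (auto intro: real_le_lsqrt dest: sqrt_le_D)
  ultimately show ?thesis unfolding hs_norm_def b_def[symmetric] by simp
qed

section \<open>The two elementary operators\<close>

text \<open>In terms of singular numbers: with \<open>x m\<close> the square of the sum of the products
  \<open>s m (X i) * s m (Y i)\<close>, the lower limit of \<open>m * x m\<close> is 0. The negation says that
  \<open>x m\<close> is at least a constant multiple of \<open>1/m\<close>, which is what puts the diagonal operator of
  the harmonic sequence into an ideal.\<close>

definition small_products ::
  "nat \<Rightarrow> (nat \<Rightarrow> 'a::complex_hilbert bop) \<Rightarrow> (nat \<Rightarrow> 'a bop) \<Rightarrow> bool" where
  "small_products n X Y \<longleftrightarrow> (\<forall>c>0. \<exists>m\<ge>1. \<exists>\<epsilon> \<delta>.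
     (\<forall>i\<in>{1..n}. approx m (\<epsilon> i) (X i) \<and> approx m (\<delta> i) (Y i)) \<and>
     real m * (\<Sum>i=1..n. \<epsilon> i * \<delta> i)\<^sup>2 < c)"

locale commuting_normals = hilbert_basis e for e :: "nat \<Rightarrow> 'a::complex_hilbert" +
  fixes n :: nat and A B :: "nat \<Rightarrow> 'a bop"
  assumes normal_A: "\<And>i. i \<in> {1..n} \<Longrightarrow> normal_bop (A i)"
    and normal_B: "\<And>i. i \<in> {1..n} \<Longrightarrow> normal_bop (B i)"
    and commute_A: "\<And>i j. i \<in> {1..n} \<Longrightarrow> j \<in> {1..n} \<Longrightarrow> A i * A j = A j * A i"
    and commute_B: "\<And>i j. i \<in> {1..n} \<Longrightarrow> j \<in> {1..n} \<Longrightarrow> B i * B j = B j * B i"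
begin

lemma adj_commute_A: "i \<in> {1..n} \<Longrightarrow> j \<in> {1..n} \<Longrightarrow> adj (A j) * A i = A i * adj (A j)"
  by (rule fuglede) (simp_all add: normal_A commute_A)

lemma adj_commute_B: "i \<in> {1..n} \<Longrightarrow> j \<in> {1..n} \<Longrightarrow> adj (B j) * B i = B i * adj (B j)"
  by (rule fuglede) (simp_all add: normal_B commute_B)

lemma adj_elem_op: "adj (elem_op n A B T) = elem_op n (\<lambda>i. adj (B i)) (\<lambda>i. adj (A i)) (adj T)"
  by (simp add: elem_op_def adj_sum mult.assoc)

lemma adj_elem_op_star:
  "adj (elem_op_star n A B T) = elem_op_star n (\<lambda>i. adj (B i)) (\<lambda>i. adj (A i)) (adj T)"
  by (simp add: elem_op_star_def adj_sum mult.assoc)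

text \<open>Both sums run over the pairs (i, j). In the summand of the first product, cyclic permutation moves
  \<open>adj (B j)\<close> from the left end to the right end; in the result, \<open>B i\<close> is moved from the right
  end to the left end, and this is the summand of the second product. By Fuglede's theorem,
  \<open>adj (B j)\<close> may be exchanged with \<open>B i\<close> and \<open>adj (A j)\<close> with \<open>A i\<close> on the way.\<close>

lemma elem_op_square_diff:
  defines "Y \<equiv> \<lambda>T i j. adj (A j * T) * (A i * T) * B i"
    and "Z \<equiv> \<lambda>T i j. adj (A j * T) * (A i * T) * adj (B j)"
  shows "adj (elem_op n A B T) * elem_op n A B T - adj (elem_op_star n A B T) * elem_op_star n A B T =
    (\<Sum>i=1..n. \<Sum>j=1..n. (adj (B j) * Y T i j - Y T i j * adj (B j)) + (Z T i j * B i - B i * Z T i j))"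
proof -
  have 1: "adj (elem_op n A B T) * elem_op n A B T = (\<Sum>i=1..n. \<Sum>j=1..n. adj (B j) * Y T i j)"
    by (simp add: elem_op_def adj_sum sum_product Y_def mult.assoc) (rule sum.swap)
  have 2: "adj (elem_op_star n A B T) * elem_op_star n A B T = (\<Sum>i=1..n. \<Sum>j=1..n. B i * Z T i j)"
  proof -
    have "B i * Z T i j = B i * adj T * A i * adj (A j) * T * adj (B j)" if "i \<in> {1..n}" "j \<in> {1..n}" for i j
      using arg_cong[OF adj_commute_A[OF that], of "\<lambda>X. B i * adj T * X * T * adj (B j)"]
      by (simp add: Z_def mult.assoc)
    then show ?thesis
      by (simp add: elem_op_star_def adj_sum sum_product mult.assoc)
  qed
  have 3: "Y T i j * adj (B j) = Z T i j * B i" if "i \<in> {1..n}" "j \<in> {1..n}" for i j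
    using adj_commute_B[OF that] by (simp add: Y_def Z_def mult.assoc)
  have "(\<Sum>i=1..n. \<Sum>j=1..n. (adj (B j) * Y T i j - Y T i j * adj (B j)) + (Z T i j * B i - B i * Z T i j)) =
      (\<Sum>i=1..n. \<Sum>j=1..n. adj (B j) * Y T i j - B i * Z T i j)"
    by (intro sum.cong refl) (simp add: 3)
  then show ?thesis unfolding 1 2 by (simp add: sum_subtractf)
qed

text \<open>Each pair (i, j) contributes two commutators. In each of them one operator is a product of three
  factors with approximants of rank m, and the other is a single such factor; a commutator thus
  requires \<open>2 * 3 * m + 2 * m\<close> vectors and has the error \<open>2 * p i * p j\<close> with
  \<open>p i = \<epsilon> i * \<delta> i\<close>. Because all pairs occur, the errors add up to a square.\<close>

lemma small_traces_square_diff: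
  assumes "\<And>i. i \<in> {1..n} \<Longrightarrow> approx m (\<epsilon> i) (A i * T)" "\<And>i. i \<in> {1..n} \<Longrightarrow> approx m (\<delta> i) (B i)"
  shows "small_traces (16 * n\<^sup>2 * m) (4 * (\<Sum>i=1..n. \<epsilon> i * \<delta> i)\<^sup>2)
    (adj (elem_op n A B T) * elem_op n A B T - adj (elem_op_star n A B T) * elem_op_star n A B T)"
proof -
  define Y where "Y i j = adj (A j * T) * (A i * T) * B i" for i j
  define Z where "Z i j = adj (A j * T) * (A i * T) * adj (B j)" for i j
  define p where "p i = \<epsilon> i * \<delta> i" for i
  have st: "small_traces (16 * m) (4 * (p i * p j))
      ((adj (B j) * Y i j - Y i j * adj (B j)) + (Z i j * B i - B i * Z i j))"
    if ij: "i \<in> {1..n}" "j \<in> {1..n}" for i j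
  proof -
    have Y: "approx (3 * m) (\<epsilon> j * \<epsilon> i * \<delta> i) (Y i j)"
      using approx_times[OF approx_times[OF approx_adj[OF assms(1)[OF ij(2)]] assms(1)[OF ij(1)]] assms(2)[OF ij(1)]]
      by (simp add: Y_def mult.commute[of 3] numeral_3_eq_3 add.assoc)
    have Z: "approx (3 * m) (\<epsilon> j * \<epsilon> i * \<delta> j) (Z i j)"
      using approx_times[OF approx_times[OF approx_adj[OF assms(1)[OF ij(2)]] assms(1)[OF ij(1)]] approx_adj[OF assms(2)[OF ij(2)]]]
      by (simp add: Z_def mult.commute[of 3] numeral_3_eq_3 add.assoc)
    from small_traces_add[OF small_traces_commutator[OF approx_adj[OF assms(2)[OF ij(2)]] Y]
        small_traces_commutator[OF Z assms(2)[OF ij(1)]]]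
    show ?thesis by (simp add: p_def algebra_simps)
  qed
  have "small_traces (card {1..n} * (card {1..n} * (16 * m))) (\<Sum>i=1..n. \<Sum>j=1..n. 4 * (p i * p j))
      (\<Sum>i=1..n. \<Sum>j=1..n. (adj (B j) * Y i j - Y i j * adj (B j)) + (Z i j * B i - B i * Z i j))"
    by (intro small_traces_sum st) auto
  also have "(\<Sum>i=1..n. \<Sum>j=1..n. 4 * (p i * p j)) = 4 * (\<Sum>i=1..n. p i)\<^sup>2"
    unfolding power2_eq_square sum_product by (simp only: sum_distrib_left)
  finally show ?thesis
    unfolding elem_op_square_diff p_def Y_def Z_def by (simp add: power2_eq_square mult_ac)
qed

text \<open>The dimension of the space is proportional to m, while the error per dimension is the square that
  \<open>small_products\<close> controls.\<close>

lemma small_products_traces: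
  assumes "small_products n (\<lambda>i. A i * T) B" "c > 0"
  shows "\<exists>F. onset F \<and> e ` {..<K} \<subseteq> F \<and>
    \<bar>(\<Sum>f\<in>F. (norm (bop_apply (elem_op n A B T) f))\<^sup>2) -
      (\<Sum>f\<in>F. (norm (bop_apply (elem_op_star n A B T) f))\<^sup>2)\<bar> < c"
proof -
  let ?D = "elem_op n A B T" and ?D' = "elem_op_star n A B T"
  \<comment> \<open>For \<open>m \<ge> 1\<close> the dimension \<open>K + 16 * n\<^sup>2 * m\<close> is at most \<open>m\<close> times a constant
    independent of m, so the error is bounded by M times a quantity that can be made small.\<close>
  define M where "M = 4 * real (K + 16 * n\<^sup>2 + 1)"
  have M: "M > 0" by (simp add: M_def del: of_nat_add of_nat_mult of_nat_power of_nat_Suc)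
  then obtain m \<epsilon> \<delta> where m: "m \<ge> 1" "real m * (\<Sum>i=1..n. \<epsilon> i * \<delta> i)\<^sup>2 < c / M"
    and ap: "\<And>i. i \<in> {1..n} \<Longrightarrow> approx m (\<epsilon> i) (A i * T)" "\<And>i. i \<in> {1..n} \<Longrightarrow> approx m (\<delta> i) (B i)"
    using assms divide_pos_pos[OF assms(2) M] unfolding small_products_def by meson
  let ?s = "(\<Sum>i=1..n. \<epsilon> i * \<delta> i)\<^sup>2"
  obtain F where F: "onset F" "e ` {..<K} \<subseteq> F"
    "cmod (\<Sum>f\<in>F. cinner (bop_apply (adj ?D * ?D - adj ?D' * ?D') f) f) \<le> real (K + 16 * n\<^sup>2 * m) * (4 * ?s)"
    using small_traces_on_basis[OF small_traces_square_diff[OF ap],  where K = K] by auto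
  have "real (K + 16 * n\<^sup>2 * m) * (4 * ?s) \<le> (real (K + 16 * n\<^sup>2 + 1) * real m) * (4 * ?s)"
  proof (rule mult_right_mono)
    have "real K * 1 \<le> real K * real m" using m(1) by (intro mult_left_mono) auto
    then show "real (K + 16 * n\<^sup>2 * m) \<le> real (K + 16 * n\<^sup>2 + 1) * real m"
      by (simp add: algebra_simps)
  qed simp
  also have "\<dots> = M * (real m * ?s)" by (simp add: M_def)
  also have "\<dots> < c" using m(2) M by (simp add: field_simps)
  finally have less: "real (K + 16 * n\<^sup>2 * m) * (4 * ?s) < c" .
  have "cinner (bop_apply (adj ?D * ?D - adj ?D' * ?D') f) f =
      complex_of_real ((norm (bop_apply ?D f))\<^sup>2 - (norm (bop_apply ?D' f))\<^sup>2)" for f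
    by (simp add: cinner_simps cinner_adj' cinner_self)
  then have "(\<Sum>f\<in>F. cinner (bop_apply (adj ?D * ?D - adj ?D' * ?D') f) f) =
      complex_of_real ((\<Sum>f\<in>F. (norm (bop_apply ?D f))\<^sup>2) - (\<Sum>f\<in>F. (norm (bop_apply ?D' f))\<^sup>2))"
    by (simp only: of_real_sum[symmetric] sum_subtractf)
  then have "\<bar>(\<Sum>f\<in>F. (norm (bop_apply ?D f))\<^sup>2) - (\<Sum>f\<in>F. (norm (bop_apply ?D' f))\<^sup>2)\<bar> < c"
    using F(3) less by (simp only: norm_of_real)
  then show ?thesis using F by blast
qed

end

text \<open>The sums over the sets F are bounded by S for X, and for Y they dominate the partial sums over the
  basis, since F contains its first K vectors.\<close>

lemma (in hilbert_basis) hs_bounded_transfer: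
  fixes X Y :: "'a bop"
  assumes X: "hs_bounded X S"
    and F: "\<And>K c. c > 0 \<Longrightarrow> \<exists>F. onset F \<and> e ` {..<K} \<subseteq> F \<and>
      \<bar>(\<Sum>f\<in>F. (norm (bop_apply X f))\<^sup>2) - (\<Sum>f\<in>F. (norm (bop_apply Y f))\<^sup>2)\<bar> < c"
  shows "hs_bounded Y S"
proof (rule hs_boundedI, rule field_le_epsilon)
  fix K and c :: real assume "c > 0"
  then obtain F where F: "onset F" "e ` {..<K} \<subseteq> F"
    "\<bar>(\<Sum>f\<in>F. (norm (bop_apply X f))\<^sup>2) - (\<Sum>f\<in>F. (norm (bop_apply Y f))\<^sup>2)\<bar> < c"
    using F by blast
  have "(\<Sum>k<K. (norm (bop_apply Y (e k)))\<^sup>2) = (\<Sum>f\<in>e ` {..<K}. (norm (bop_apply Y f))\<^sup>2)"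
    by (subst sum.reindex) (auto intro: inj_on_subset[OF orthonormal_basis_inj[OF basis]])
  also have "\<dots> \<le> (\<Sum>f\<in>F. (norm (bop_apply Y f))\<^sup>2)"
    using F(1,2) by (intro sum_mono2) (auto simp: onset_def)
  also have "\<dots> \<le> (\<Sum>f\<in>F. (norm (bop_apply X f))\<^sup>2) + c" using F(3) by linarith
  also have "\<dots> \<le> S + c" using X F(1) by (simp add: hs_bounded_def)
  finally show "(\<Sum>k<K. (norm (bop_apply Y (e k)))\<^sup>2) \<le> S + c" .
qed

lemma (in commuting_normals) hs_bounded_elem_op_iff:
  assumes "small_products n (\<lambda>i. A i * T) B"
  shows "hs_bounded (elem_op n A B T) S \<longleftrightarrow> hs_bounded (elem_op_star n A B T) S"
  using hs_bounded_transfer small_products_traces[OF assms] by (metis abs_minus_commute)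

section \<open>Diagonal operators in principal ideals\<close>

lemma two_sided_ideal_principal: "two_sided_ideal (principal_ideal X)"
  unfolding principal_ideal_def two_sided_ideal_def by blast

lemma principal_ideal_times: "L * X * R \<in> principal_ideal X"
  unfolding principal_ideal_def two_sided_ideal_def by blast

lemma ideal_prodI: "X \<in> M \<Longrightarrow> Y \<in> N \<Longrightarrow> X * Y \<in> ideal_prod M N"
  unfolding ideal_prod_def by (intro complex_vector.span_base) blast

context hilbert_basis
begin

lemma fin_rank_proj:
  fixes F :: "'a set"
  assumes "finite F"
  shows "fin_rank (card F) (\<Sum>f\<in>F. rank_one f f)"
proof -
  obtain h where "bij_betw h {..<card F} F"
    using ex_bij_betw_nat_finite[OF assms] by (auto simp: atLeast0LessThan)
  then have "(\<Sum>f\<in>F. rank_one f f) = (\<Sum>j<card F. rank_one (h j) (h j))"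
    by (rule sum.reindex_bij_betw[symmetric])
  then show ?thesis unfolding fin_rank_def by (intro exI)
qed

text \<open>X followed on the right by the projection onto the span of W has rank at most k, so the norm N of
  X on the orthogonal complement of W is an approximation error. A vector at which more
  than half of N is attained exists even where N is not attained, and the projection of such a
  vector onto the complement is the required one.\<close>

lemma almost_maximal_vector:
  fixes X :: "'a bop"
  assumes "finite W" "card W \<le> k"
  shows "\<exists>f. norm f \<le> 1 \<and> (\<forall>w\<in>W. cinner f w = 0) \<and> approx k (2 * norm (bop_apply X f)) X"
proof -
  have "onset ({} :: 'a set)" by (simp add: onset_def)
  from onset_extend[OF assms(1) this] obtain F where
    F: "onset F" "card F \<le> k" "\<forall>w\<in>W. proj F w = w"
    using assms(2) by auto
  define P where "P = (\<Sum>f\<in>F. rank_one f f)"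
  have P: "bop_apply P x = proj F x" for x by (simp add: P_def bop_apply_sum rank_one.rep_eq proj_def)
  have "fin_rank (card F) P" unfolding P_def using F(1) by (intro fin_rank_proj) (simp add: onset_def)
  then have rk: "fin_rank k (X * P)" by (intro fin_rank_left fin_rank_mono[OF _ F(2)])
  define Q where "Q = X - X * P"
  have Q: "bop_apply Q x = bop_apply X (x - proj F x)" for x by (simp add: Q_def P bop_diff)
  define N where "N = onorm (bop_apply Q)"
  have N: "norm (bop_apply Q x) \<le> N * norm x" for x
    unfolding N_def by (rule onorm[OF bop_bounded_linear])
  have N0: "N \<ge> 0" unfolding N_def by (rule onorm_pos_le[OF bop_bounded_linear])
  have ap: "approx k \<epsilon> X" if "N \<le> \<epsilon>" for \<epsilon>
  proof -
    have "norm (bop_apply (X - X * P) x) \<le> \<epsilon> * norm x" for x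
      using N[of x] mult_right_mono[OF that norm_ge_zero[of x]] unfolding Q_def by linarith
    then show ?thesis unfolding approx_def using rk N0 that by (metis order_trans)
  qed
  show ?thesis
  proof (cases "N = 0")
    case True
    then show ?thesis using ap[of 0] by (intro exI[of _ 0]) simp
  next
    case False
    have "\<exists>h. norm (bop_apply Q h) > N / 2 * norm h"
    proof (rule ccontr)
      assume "\<not> ?thesis"
      then have "onorm (bop_apply Q) \<le> N / 2" using N0 by (intro onorm_bound) (simp_all add: not_less)
      then show False using False N0 by (simp add: N_def)
    qed
    then obtain h where h: "norm (bop_apply Q h) > N / 2 * norm h" by blast
    then have h0: "h \<noteq> 0" by auto
    define f where "f = complex_of_real (1 / norm h) *\<^sub>C (h - proj F h)"
    have "norm f \<le> 1"
      using norm_diff_proj_le[OF F(1), of h] h0 by (simp add: f_def norm_divide)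
    moreover have "cinner f w = 0" if "w \<in> W" for w
      using cinner_diff_proj[OF F(1), of h w] F(3) that by (simp add: f_def cinner_simps)
    moreover have "norm (bop_apply X f) = norm (bop_apply Q h) / norm h"
      by (simp add: f_def bop_scaleC Q norm_divide)
    then have "N / 2 < norm (bop_apply X f)"
      using h h0 by (simp add: pos_less_divide_eq)
    then have "N \<le> 2 * norm (bop_apply X f)" by simp
    ultimately show ?thesis using ap by blast
  qed
qed

text \<open>A substitute for the singular value decomposition that applies also to operators that are not
  compact. Choose vectors \<open>f k\<close> successively, each with almost maximal image among the vectors
  orthogonal to the earlier ones and to their images under X* X. Then the \<open>f k\<close> are orthogonal
  and so are the \<open>X (f k)\<close>; hence bounded operators on both sides turn X into the diagonal operator
  of the norms of the \<open>X (f k)\<close>. There are two orthogonality conditions for each earlier vector,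
  whence the index \<open>2 * k\<close>.\<close>

lemma diag_singular_values:
  fixes X :: "'a bop"
  shows "\<exists>\<sigma> M. (\<forall>k. 0 \<le> \<sigma> k \<and> \<sigma> k \<le> M \<and> approx (2 * k) (2 * \<sigma> k) X) \<and>
    diag_bop e (\<lambda>k. complex_of_real (\<sigma> k)) \<in> principal_ideal X"
proof -
  define G where "G x = bop_apply (adj X) (bop_apply X x)" for x
  define P where "P f k r \<longleftrightarrow> norm r \<le> 1 \<and> (\<forall>w \<in> f ` {..<k} \<union> (G \<circ> f) ` {..<k}. cinner r w = 0) \<and>
    approx (2 * k) (2 * norm (bop_apply X r)) X" for f and k :: nat and r :: 'a
  have "\<exists>f. \<forall>k. P f k (f k)"
  proof (rule dependent_wellorder_choice)
    fix f g :: "nat \<Rightarrow> 'a" and k and r :: 'a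
    assume "\<And>j. j < k \<Longrightarrow> f j = g j"
    then have "f ` {..<k} = g ` {..<k}" "(G \<circ> f) ` {..<k} = (G \<circ> g) ` {..<k}" by (auto intro!: image_cong)
    then show "P f k r = P g k r" unfolding P_def by simp
  next
    fix f :: "nat \<Rightarrow> 'a" and k :: nat
    have "card (f ` {..<k} \<union> (G \<circ> f) ` {..<k}) \<le> k + k"
      by (intro order_trans[OF card_Un_le] add_mono order_trans[OF card_image_le]) auto
    then show "\<exists>r. P f k r"
      unfolding P_def by (intro almost_maximal_vector) auto
  qed
  then obtain f where "\<forall>k. P f k (f k)" ..
  then have f1: "\<And>k. norm (f k) \<le> 1" and f2: "\<And>j k. j < k \<Longrightarrow> cinner (f k) (f j) = 0"
    and f3: "\<And>j k. j < k \<Longrightarrow> cinner (f k) (G (f j)) = 0"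
    and ap: "\<And>k. approx (2 * k) (2 * norm (bop_apply X (f k))) X"
    unfolding P_def by auto
  have f4: "cinner (f i) (f j) = 0" if "i \<noteq> j" for i j
    using that f2[of i j] f2[of j i] cinner_eq_zero_commute by (cases i j rule: linorder_cases) auto
  define \<sigma> where "\<sigma> k = norm (bop_apply X (f k))" for k
  define g where "g k = complex_of_real (1 / \<sigma> k) *\<^sub>C bop_apply X (f k)" for k
  have X: "cinner (bop_apply X (f i)) (bop_apply X (f j)) = 0" if "i \<noteq> j" for i j
  proof -
    have "cinner (bop_apply X (f k)) (bop_apply X (f l)) = 0" if "l < k" for k l
      using f3[OF that] by (simp add: G_def flip: cinner_adj)
    then show ?thesis
      using that cinner_eq_zero_commute by (cases i j rule: linorder_cases) auto
  qed
  obtain M where M: "M > 0" "\<And>x. norm (bop_apply X x) \<le> M * norm x"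
    using bop_bound[of X] by metis
  have \<sigma>: "0 \<le> \<sigma> k" "\<sigma> k \<le> M" for k
    using order_trans[OF M(2)[of "f k"] mult_left_mono[OF f1[of k], of M]] M(1) by (auto simp: \<sigma>_def)
  obtain R where R: "\<And>k. bop_apply R (e k) = f k"
    using bop_with_values[of f 1] f1 f4 by metis
  have "norm (g k) \<le> 1" for k by (cases "\<sigma> k = 0") (simp_all add: g_def norm_divide, simp_all add: \<sigma>_def)
  then obtain U where U: "\<And>k. bop_apply U (e k) = g k"
    using bop_with_values[of g 1] X by (auto simp: g_def cinner_simps)
  have "adj U * X * R = diag_bop e (\<lambda>k. complex_of_real (\<sigma> k))"
  proof (rule bop_basis_ext, rule cinner_basis_ext)
    fix k j
    have "cinner (bop_apply (adj U * X * R) (e k)) (e j) = cinner (bop_apply X (f k)) (g j)"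
      by (simp add: R U cinner_adj')
    also have "\<dots> = (if j = k then complex_of_real (\<sigma> k) else 0)"
      using X[of k j] by (simp add: g_def cinner_simps cinner_self flip: \<sigma>_def) (simp add: power2_eq_square)
    also have "\<dots> = cinner (bop_apply (diag_bop e (\<lambda>k. complex_of_real (\<sigma> k))) (e k)) (e j)"
      using \<sigma> by (subst bop_apply_diag[of _ M]) (auto simp: cinner_simps cinner_basis)
    finally show "cinner (bop_apply (adj U * X * R) (e k)) (e j) =
        cinner (bop_apply (diag_bop e (\<lambda>k. complex_of_real (\<sigma> k))) (e k)) (e j)" .
  qed
  then have "diag_bop e (\<lambda>k. complex_of_real (\<sigma> k)) \<in> principal_ideal X"
    using principal_ideal_times[of "adj U" X R] by simp
  then show ?thesis using \<sigma> ap unfolding \<sigma>_def[symmetric] by blast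
qed

text \<open>If \<open>r\<close> is the square root of the harmonic sequence, the failure of
  \<open>small_products\<close> says that \<open>r\<close> is at most a constant multiple of the sum of the
  products of the singular numbers. Then the diagonal operator of \<open>r\<close> lies in the sum of
  the products of the principal ideals, and its square lies in the square of that sum.\<close>

lemma diag_omega_in_ideal:
  fixes X Y :: "nat \<Rightarrow> 'a bop"
  assumes "\<not> small_products n X Y"
  shows "diag_bop e omega \<in> ideal_square
    (ideal_sum {1..n} (\<lambda>i. ideal_prod (principal_ideal (X i)) (principal_ideal (Y i))))"
proof -
  define D where "D \<sigma> = diag_bop e (\<lambda>k. complex_of_real (\<sigma> k))" for \<sigma>
  have D: "bop_apply (D \<sigma>) (e k) = complex_of_real (\<sigma> k) *\<^sub>C e k" if "\<And>k. 0 \<le> \<sigma> k \<and> \<sigma> k \<le> M" for \<sigma> M k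
    unfolding D_def by (rule bop_apply_diag[of _ M]) (use that in simp)
  obtain c where c: "c > 0" and *: "\<And>m \<epsilon> \<delta>. m \<ge> 1 \<Longrightarrow>
      (\<And>i. i \<in> {1..n} \<Longrightarrow> approx m (\<epsilon> i) (X i) \<and> approx m (\<delta> i) (Y i)) \<Longrightarrow>
      c \<le> real m * (\<Sum>i=1..n. \<epsilon> i * \<delta> i)\<^sup>2"
    using assms unfolding small_products_def not_all not_imp not_ex by (meson not_le)
  obtain \<sigma> M where \<sigma>: "\<And>i k. 0 \<le> \<sigma> i k \<and> \<sigma> i k \<le> M i" "\<And>i k. approx (2 * k) (2 * \<sigma> i k) (X i)"
    "\<And>i. D (\<sigma> i) \<in> principal_ideal (X i)"
    using diag_singular_values[of "X _"] unfolding D_def by metis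
  obtain \<tau> M' where \<tau>: "\<And>i k. 0 \<le> \<tau> i k \<and> \<tau> i k \<le> M' i" "\<And>i k. approx (2 * k) (2 * \<tau> i k) (Y i)"
    "\<And>i. D (\<tau> i) \<in> principal_ideal (Y i)"
    using diag_singular_values[of "Y _"] unfolding D_def by metis
  define s where "s k = (\<Sum>i=1..n. \<sigma> i k * \<tau> i k)" for k
  define r where "r k = sqrt (1 / real (k + 1))" for k
  have s0: "s k \<ge> 0" for k unfolding s_def by (intro sum_nonneg) (simp add: \<sigma> \<tau>)
  \<comment> \<open>The approximants of rank \<open>2 * k\<close> are used with \<open>m = 2 * (k + 1)\<close>, which is positive also
    for \<open>k = 0\<close>.\<close>
  have s: "c \<le> 32 * real (k + 1) * (s k)\<^sup>2" for k
  proof -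
    have "c \<le> real (2 * (k + 1)) * (\<Sum>i=1..n. (2 * \<sigma> i k) * (2 * \<tau> i k))\<^sup>2"
      by (rule *) (auto intro!: approx_mono[OF \<sigma>(2)] approx_mono[OF \<tau>(2)])
    also have "(\<Sum>i=1..n. (2 * \<sigma> i k) * (2 * \<tau> i k)) = 4 * s k"
      by (simp add: s_def sum_distrib_left mult_ac)
    finally show ?thesis by (simp add: power_mult_distrib algebra_simps)
  qed
  have spos: "s k > 0" for k using s[of k] s0[of k] c by (cases "s k = 0") auto
  define t where "t k = r k / s k" for k
  have t: "0 \<le> t k \<and> t k \<le> sqrt (32 / c)" for k
  proof -
    have "(t k)\<^sup>2 = 1 / (real (k + 1) * (s k)\<^sup>2)" by (simp add: t_def r_def power_divide)
    also have "\<dots> \<le> 32 / c" using s[of k] c spos[of k] by (simp add: field_simps)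
    finally have "t k \<le> sqrt (32 / c)" by (rule real_le_rsqrt)
    then show ?thesis using spos[of k] by (simp add: t_def r_def)
  qed
  have r: "0 \<le> r k \<and> r k \<le> 1" for k by (simp add: r_def)
  have Dr: "D r = (\<Sum>i=1..n. D (\<sigma> i) * (D (\<tau> i) * D t))"
  proof (rule bop_basis_ext)
    fix k
    have "(\<Sum>i=1..n. \<sigma> i k * (\<tau> i k * t k)) = s k * t k"
      by (simp add: s_def sum_distrib_right mult.assoc)
    also have "\<dots> = r k" using spos[of k] by (simp add: t_def)
    finally have "r k = (\<Sum>i=1..n. \<sigma> i k * (\<tau> i k * t k))" ..
    then show "bop_apply (D r) (e k) = bop_apply (\<Sum>i=1..n. D (\<sigma> i) * (D (\<tau> i) * D t)) (e k)"
      by (simp add: bop_apply_sum D[OF r] D[OF \<sigma>(1)] D[OF \<tau>(1)] D[OF t] bop_scaleC scaleC_scaleC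
          complex_vector.scale_sum_left mult_ac)
  qed
  have "D (\<tau> i) * D t \<in> principal_ideal (Y i)" for i
    using \<tau>(3)[of i] two_sided_ideal_principal unfolding two_sided_ideal_def by blast
  then have "D r \<in> ideal_sum {1..n} (\<lambda>i. ideal_prod (principal_ideal (X i)) (principal_ideal (Y i)))"
    unfolding ideal_sum_def Dr using \<sigma>(3) by (blast intro: ideal_prodI)
  then have "D r * D r \<in> ideal_square
      (ideal_sum {1..n} (\<lambda>i. ideal_prod (principal_ideal (X i)) (principal_ideal (Y i))))"
    unfolding ideal_square_def by (blast intro: ideal_prodI)
  moreover have "D r * D r = diag_bop e omega"
  proof (rule bop_basis_ext)
    fix k
    have "bop_apply (diag_bop e omega) (e k) = omega k *\<^sub>C e k"
      by (rule bop_apply_diag[of _ 1]) (simp add: omega_def norm_divide del: of_nat_Suc)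
    moreover have "complex_of_real (r k) * complex_of_real (r k) = omega k"
      unfolding of_real_mult[symmetric] by (simp add: r_def omega_def)
    ultimately show "bop_apply (D r * D r) (e k) = bop_apply (diag_bop e omega) (e k)"
      by (simp add: D[OF r] bop_scaleC scaleC_scaleC)
  qed
  ultimately show ?thesis by simp
qed

lemma normal_adj: "normal_bop X \<Longrightarrow> normal_bop (adj (X :: 'a bop))"
  by (simp add: normal_bop_def)

lemma approx_adj_iff: "approx k \<epsilon> (adj (X :: 'a bop)) \<longleftrightarrow> approx k \<epsilon> X"
  using approx_adj by (metis adj_adj)

end

section \<open>The Hilbert--Schmidt norms of the two elementary operators\<close>

lemma small_products_commute:
  assumes "small_products n X Y"
  shows "small_products n Y X"
  unfolding small_products_def
proof (intro allI impI)
  fix c :: real assume "c > 0"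
  then obtain m \<epsilon> \<delta> where "m \<ge> 1" "\<forall>i\<in>{1..n}. approx m (\<epsilon> i) (X i) \<and> approx m (\<delta> i) (Y i)"
    "real m * (\<Sum>i=1..n. \<epsilon> i * \<delta> i)\<^sup>2 < c"
    using assms unfolding small_products_def by blast
  then show "\<exists>m\<ge>1. \<exists>\<epsilon> \<delta>. (\<forall>i\<in>{1..n}. approx m (\<epsilon> i) (Y i) \<and> approx m (\<delta> i) (X i)) \<and>
      real m * (\<Sum>i=1..n. \<epsilon> i * \<delta> i)\<^sup>2 < c"
    by (intro exI[of _ m] conjI exI[of _ \<delta>] exI[of _ \<epsilon>]) (simp_all add: mult.commute)
qed

text \<open>The harmonic diagonal operator avoids one of the four ideals. Singular numbers do not change when
  an operator is replaced by its adjoint, so each of the four cases becomes the first one after a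
  change of the data: \<open>adj A, adj B, T\<close> exchanges the two elementary operators, the data
  \<open>adj B, adj A, adj T\<close> replace both by their adjoints, and \<open>B, A, adj T\<close> do both.\<close>

lemma (in commuting_normals) hs_bounded_elem_op_iff_ideal:
  assumes "diag_bop e omega \<notin> ideal_Delta n A B T"
  shows "hs_bounded (elem_op n A B T) S \<longleftrightarrow> hs_bounded (elem_op_star n A B T) S"
proof -
  interpret adj: commuting_normals e n "\<lambda>i. adj (A i)" "\<lambda>i. adj (B i)"
    by unfold_locales (auto simp: normal_adj normal_A normal_B commute_A commute_B simp flip: adj_times)
  interpret swap: commuting_normals e n B A
    by unfold_locales (auto simp: normal_A normal_B commute_A commute_B)
  interpret adj_swap: commuting_normals e n "\<lambda>i. adj (B i)" "\<lambda>i. adj (A i)"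
    by unfold_locales (auto simp: normal_adj normal_A normal_B commute_A commute_B simp flip: adj_times)
  from assms consider
      "small_products n (\<lambda>i. A i * T) B"
    | "small_products n (\<lambda>i. adj (A i) * T) B"
    | "small_products n A (\<lambda>i. T * B i)"
    | "small_products n A (\<lambda>i. T * adj (B i))"
    unfolding ideal_Delta_def Let_def using diag_omega_in_ideal by blast
  then show ?thesis
  proof cases
    case 1
    then show ?thesis by (rule hs_bounded_elem_op_iff)
  next
    case 2
    then have "small_products n (\<lambda>i. adj (A i) * T) (\<lambda>i. adj (B i))"
      by (simp add: small_products_def approx_adj_iff)
    from adj.hs_bounded_elem_op_iff[OF this] show ?thesis
      by (simp add: elem_op_def elem_op_star_def)
  next
    case 3
    have "approx k \<epsilon> (adj (B i) * adj T) \<longleftrightarrow> approx k \<epsilon> (T * B i)" for k \<epsilon> i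
      using approx_adj_iff[of k \<epsilon> "T * B i"] by simp
    then have "small_products n (\<lambda>i. adj (B i) * adj T) (\<lambda>i. adj (A i))"
      using small_products_commute[OF 3] by (simp add: small_products_def approx_adj_iff)
    from adj_swap.hs_bounded_elem_op_iff[OF this] show ?thesis
      unfolding adj_elem_op[symmetric] adj_elem_op_star[symmetric] hs_bounded_adj .
  next
    case 4
    have "approx k \<epsilon> (B i * adj T) \<longleftrightarrow> approx k \<epsilon> (T * adj (B i))" for k \<epsilon> i
      using approx_adj_iff[of k \<epsilon> "T * adj (B i)"] by simp
    then have "small_products n (\<lambda>i. B i * adj T) A"
      using small_products_commute[OF 4] by (simp add: small_products_def)
    from swap.hs_bounded_elem_op_iff[OF this] show ?thesis
      using adj_elem_op[of T] adj_elem_op_star[of T] hs_bounded_adj[of "elem_op n A B T" S] hs_bounded_adj[of "elem_op_star n A B T" S]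
      by (simp add: elem_op_def elem_op_star_def)
  qed
qed

theorem proposition5p7:
  fixes A B :: "nat \<Rightarrow> 'a::complex_hilbert bop"
    and T :: "'a bop"
    and e :: "nat \<Rightarrow> 'a"
    and n :: nat
  assumes "separable_space (euclidean :: 'a topology)"
    and "infinite_dimensional TYPE('a)"
    and "n \<ge> 1"
    and "\<forall>i\<in>{1..n}. normal_bop (A i)"
    and "\<forall>i\<in>{1..n}. normal_bop (B i)"
    and "\<forall>i\<in>{1..n}. \<forall>j\<in>{1..n}. A i * A j = A j * A i"
    and "\<forall>i\<in>{1..n}. \<forall>j\<in>{1..n}. B i * B j = B j * B i"
    and "orthonormal_basis e"
    and "diag_bop e omega \<notin> ideal_Delta n A B T"
    and "hilbert_schmidt (elem_op n A B T)"
  shows "hilbert_schmidt (elem_op_star n A B T) \<and>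
         hs_norm (elem_op n A B T) = hs_norm (elem_op_star n A B T)"
proof -
  interpret commuting_normals e n A B using assms by unfold_locales auto
  have basis: "hilbert_basis e" by unfold_locales
  have iff: "hs_bounded (elem_op n A B T) S \<longleftrightarrow> hs_bounded (elem_op_star n A B T) S" for S
    using assms(9) by (rule hs_bounded_elem_op_iff_ideal)
  then have hs: "hilbert_schmidt (elem_op_star n A B T)"
    using assms(10) by (simp add: hilbert_schmidt_iff[OF basis])
  have "hs_norm (elem_op n A B T) \<le> S \<longleftrightarrow> hs_norm (elem_op_star n A B T) \<le> S" for S
    by (simp add: hs_norm_le_iff[OF basis assms(10)] hs_norm_le_iff[OF basis hs] iff)
  then show ?thesis using hs by (metis order_antisym order_refl)
qed

end
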